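(* Assume the sequence $\{(x^s_t)_{t=1}^m\}_{s=1}^S$ is generated by the ZO-ProxSVRG algorithm using the coordinate smoothing gradient estimator (CooSGE) with smoothing parameter $\mu$ (algorithm, estimator and assumptions as in the context), and define a sequence $\{c_t\}$ as follows: for $s=1,2,\dots,S$, $$c_t=\begin{cases}\dfrac{\delta_n L^2 d\,\eta}{b}+c_{t+1}(1+\beta), & 0\le t\le m-1,\\[2mm] 0, & t=m,\end{cases}$$ where $\beta>0$. Let $T=mS$, let $\eta=\frac{\rho}{dL}$ with $0<\rho<\frac12$, and suppose $b$ satisfies $$\frac{8\rho^2m^2}{b}+\rho\le 1 .$$ Then, for $x^s_t$ the output of the algorithm, i.e. the iterate chosen uniformly at random from $\{(x^s_t)_{t=1}^m\}_{s=1}^S$, $$\mathbb{E}\|g_\eta(x^s_t)\|^2\le \frac{\mathbb{E}[F(x^1_0)-F(x_* )]}{T\gamma}+\frac{L^2d^2\mu^2\eta}{4\gamma},$$ where $\gamma=\frac{\eta}{2}-L\eta^2$ and $x_*$ is an optimal solution of the problem $\min_{x\in\mathbb{R}^d}F(x)$. Further, let $b=[n^{2/3}]$, $m=[n^{1/3}]$, $\rho=\frac14$ and $\mu=O\big(\frac{1}{\sqrt{dT}}\big)$; then $$\mathbb{E}\|g_\eta(x^s_t)\|^2\le\frac{16dL\,\mathbb{E}[F(x^1_0)-F(x_* )]}{T}+O\Big(\frac dT\Big).$$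
   Context: Problem: minimize $F(x)=f(x)+\psi(x)$ over $x\in\mathbb{R}^d$, with $f(x)=\frac1n\sum_{i=1}^n f_i(x)$, where each $f_i$ is a nonconvex and smooth loss function and $\psi$ is a convex and nonsmooth regularization term. Standing assumptions: (1) for every $i\in\{1,\dots,n\}$, $\|\nabla f_i(x)-\nabla f_i(y)\|\le L\|x-y\|$ for all $x,y\in\mathbb{R}^d$, with $L>0$; (2) the gradients are bounded, $\|\nabla f_i(x)\|^2\le\sigma^2$ for all $i=1,\dots,n$. Proximal operator: $\mathrm{Prox}_{\eta\psi}(x)=\arg\min_{y\in\mathbb{R}^d}\{\psi(y)+\frac1{2\eta}\|y-x\|^2\}$. Gradient mapping: $g_\eta(x)=\frac1\eta\big(x-\mathrm{Prox}_{\eta\psi}(x-\eta\nabla f(x))\big)$. CooSGE with smoothing parameter $\mu>0$ (all coordinate-wise parameters $\mu_j$ equal to $\mu$): $\hat\nabla f_i(x)=\sum_{j=1}^d\frac{f_i(x+\mu e_j)-f_i(x-\mu e_j)}{2\mu}e_j$, where $e_j$ is the $j$-th standard basis vector. For a mini-batch $\mathcal I$ of size $b$, $\hat\nabla f_{\mathcal I}(x)=\frac1b\sum_{i\in\mathcal I}\hat\nabla f_i(x)$; also $\hat\nabla f(x)=\frac1n\sum_{i=1}^n\hat\nabla f_i(x)$. ZO-ProxSVRG algorithm: inputs are the mini-batch size $b$, the number $S$ of outer loops, the number $m$ of inner iterations, and the step size $\eta>0$; initialize $x^1_0=\tilde x^1\in\mathbb{R}^d$. For $s=1,\dots,S$: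 compute $\hat\nabla f(\tilde x^s)$; for $t=0,1,\dots,m-1$: pick uniformly at random a mini-batch $\mathcal I_t\subseteq\{1,\dots,n\}$ with $|\mathcal I_t|=b$, set $\hat v^s_t=\hat\nabla f_{\mathcal I_t}(x^s_t)-\hat\nabla f_{\mathcal I_t}(\tilde x^s)+\hat\nabla f(\tilde x^s)$ and $x^s_{t+1}=\mathrm{Prox}_{\eta\psi}(x^s_t-\eta\hat v^s_t)$. After the inner loop set $\tilde x^{s+1}=x^s_m$ and $x^{s+1}_0=x^s_m$. Output: an iterate chosen uniformly at random from $\{(x^s_t)_{t=1}^m\}_{s=1}^S$. The constant $\delta_n\in[0,1]$ is: $\delta_n=1$ if the mini-batch contains i.i.d. samples with replacement; if the samples are drawn without replacement, $\delta_n=1$ when $b<n$ and $\delta_n=0$ otherwise. $[\cdot]$ denotes integer part. $\mathbb{E}$ denotes expectation over the randomness of the algorithm. *)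

theory Defs
  imports "HOL-Probability.Probability"
begin

text \<open>
  The definite description below is meaningful where \<open>h\<close> is differentiable, the minimiser in
  \<open>prox\<close> where \<open>\<psi>\<close> is convex (and finite everywhere) and \<open>\<eta> > 0\<close>; both are then unique.
\<close>

definition gradient :: "('a::real_inner \<Rightarrow> real) \<Rightarrow> 'a \<Rightarrow> 'a" where
  "gradient h x = (THE D. GDERIV h x :> D)"

definition prox :: "real \<Rightarrow> (real ^ 'd \<Rightarrow> real) \<Rightarrow> real ^ 'd \<Rightarrow> real ^ 'd" where
  "prox \<eta> \<psi> x = (ARG_MIN (\<lambda>y. \<psi> y + 1 / (2 * \<eta>) * (norm (y - x))\<^sup>2) y. True)"

definition avg_loss :: "nat \<Rightarrow> (nat \<Rightarrow> real ^ 'd \<Rightarrow> real) \<Rightarrow> real ^ 'd \<Rightarrow> real" where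
  "avg_loss n f x = (1 / real n) * (\<Sum>i=1..n. f i x)"

definition objective ::
    "nat \<Rightarrow> (nat \<Rightarrow> real ^ 'd \<Rightarrow> real) \<Rightarrow> (real ^ 'd \<Rightarrow> real) \<Rightarrow> real ^ 'd \<Rightarrow> real" where
  "objective n f \<psi> x = avg_loss n f x + \<psi> x"

definition gradient_mapping ::
    "real \<Rightarrow> (real ^ 'd \<Rightarrow> real) \<Rightarrow> (real ^ 'd \<Rightarrow> real) \<Rightarrow> real ^ 'd \<Rightarrow> real ^ 'd" where
  "gradient_mapping \<eta> h \<psi> x = (1 / \<eta>) *\<^sub>R (x - prox \<eta> \<psi> (x - \<eta> *\<^sub>R gradient h x))"

definition coosge :: "real \<Rightarrow> (real ^ 'd \<Rightarrow> real) \<Rightarrow> real ^ 'd \<Rightarrow> real ^ 'd" where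
  "coosge \<mu> h x =
     (\<Sum>j\<in>UNIV. ((h (x + \<mu> *\<^sub>R axis j 1) - h (x - \<mu> *\<^sub>R axis j 1)) / (2 * \<mu>)) *\<^sub>R axis j 1)"

text \<open>
  A mini-batch is a multiset of indices from \<open>{1..n}\<close>: a set when sampling without
  replacement, possibly with repetitions when sampling with replacement.
\<close>

definition coosge_batch ::
    "real \<Rightarrow> (nat \<Rightarrow> real ^ 'd \<Rightarrow> real) \<Rightarrow> nat multiset \<Rightarrow> real ^ 'd \<Rightarrow> real ^ 'd" where
  "coosge_batch \<mu> f I x = (1 / real (size I)) *\<^sub>R (\<Sum>i\<in>#I. coosge \<mu> (f i) x)"

definition coosge_full ::
    "real \<Rightarrow> nat \<Rightarrow> (nat \<Rightarrow> real ^ 'd \<Rightarrow> real) \<Rightarrow> real ^ 'd \<Rightarrow> real ^ 'd" where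
  "coosge_full \<mu> n f x = (1 / real n) *\<^sub>R (\<Sum>i=1..n. coosge \<mu> (f i) x)"

datatype sampling = With_Replacement | Without_Replacement

fun delta :: "sampling \<Rightarrow> nat \<Rightarrow> nat \<Rightarrow> real" where
  "delta With_Replacement b n = 1"
| "delta Without_Replacement b n = (if b < n then 1 else 0)"

fun batch_pmf :: "sampling \<Rightarrow> nat \<Rightarrow> nat \<Rightarrow> nat multiset pmf" where
  "batch_pmf With_Replacement n b = map_pmf mset (replicate_pmf b (pmf_of_set {1..n}))"
| "batch_pmf Without_Replacement n b =
     map_pmf mset_set (pmf_of_set {A. A \<subseteq> {1..n} \<and> card A = b})"

text \<open>
  All the randomness of the inner loops: independent mini-batches, one for each outer
  index \<open>s \<in> {1..S}\<close> and inner index \<open>t \<in> {0..<m}\<close>.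
\<close>

definition batches_pmf ::
    "sampling \<Rightarrow> nat \<Rightarrow> nat \<Rightarrow> nat \<Rightarrow> nat \<Rightarrow> (nat \<times> nat \<Rightarrow> nat multiset) pmf" where
  "batches_pmf samp n b S m = Pi_pmf ({1..S} \<times> {0..<m}) {#} (\<lambda>_. batch_pmf samp n b)"

definition vhat ::
    "real \<Rightarrow> nat \<Rightarrow> (nat \<Rightarrow> real ^ 'd \<Rightarrow> real) \<Rightarrow> nat multiset \<Rightarrow> real ^ 'd \<Rightarrow> real ^ 'd
       \<Rightarrow> real ^ 'd" where
  "vhat \<mu> n f I xt x' = coosge_batch \<mu> f I xt - coosge_batch \<mu> f I x' + coosge_full \<mu> n f x'"

primrec inner_iterate ::
    "real \<Rightarrow> nat \<Rightarrow> (nat \<Rightarrow> real ^ 'd \<Rightarrow> real) \<Rightarrow> (real ^ 'd \<Rightarrow> real) \<Rightarrow> real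
       \<Rightarrow> (nat \<Rightarrow> nat multiset) \<Rightarrow> real ^ 'd \<Rightarrow> nat \<Rightarrow> real ^ 'd" where
  "inner_iterate \<mu> n f \<psi> \<eta> I x' 0 = x'"
| "inner_iterate \<mu> n f \<psi> \<eta> I x' (Suc t) =
     (let xt = inner_iterate \<mu> n f \<psi> \<eta> I x' t
      in prox \<eta> \<psi> (xt - \<eta> *\<^sub>R vhat \<mu> n f (I t) xt x'))"

text \<open>
  The reference point of outer loop \<open>s\<close>; outer loops are numbered from 1, so the value at
  \<open>s = 0\<close> is never used.
\<close>

fun snapshot ::
    "real \<Rightarrow> nat \<Rightarrow> (nat \<Rightarrow> real ^ 'd \<Rightarrow> real) \<Rightarrow> (real ^ 'd \<Rightarrow> real) \<Rightarrow> real \<Rightarrow> nat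
       \<Rightarrow> real ^ 'd \<Rightarrow> (nat \<times> nat \<Rightarrow> nat multiset) \<Rightarrow> nat \<Rightarrow> real ^ 'd" where
  "snapshot \<mu> n f \<psi> \<eta> m x0 B 0 = x0"
| "snapshot \<mu> n f \<psi> \<eta> m x0 B (Suc 0) = x0"
| "snapshot \<mu> n f \<psi> \<eta> m x0 B (Suc (Suc s)) =
     inner_iterate \<mu> n f \<psi> \<eta> (\<lambda>t. B (Suc s, t)) (snapshot \<mu> n f \<psi> \<eta> m x0 B (Suc s)) m"

definition zo_iterate ::
    "real \<Rightarrow> nat \<Rightarrow> (nat \<Rightarrow> real ^ 'd \<Rightarrow> real) \<Rightarrow> (real ^ 'd \<Rightarrow> real) \<Rightarrow> real \<Rightarrow> nat
       \<Rightarrow> real ^ 'd \<Rightarrow> (nat \<times> nat \<Rightarrow> nat multiset) \<Rightarrow> nat \<Rightarrow> nat \<Rightarrow> real ^ 'd" where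
  "zo_iterate \<mu> n f \<psi> \<eta> m x0 B s t =
     inner_iterate \<mu> n f \<psi> \<eta> (\<lambda>t. B (s, t)) (snapshot \<mu> n f \<psi> \<eta> m x0 B s) t"

definition zo_output ::
    "sampling \<Rightarrow> real \<Rightarrow> nat \<Rightarrow> (nat \<Rightarrow> real ^ 'd \<Rightarrow> real) \<Rightarrow> (real ^ 'd \<Rightarrow> real) \<Rightarrow> real
       \<Rightarrow> nat \<Rightarrow> nat \<Rightarrow> nat \<Rightarrow> real ^ 'd \<Rightarrow> (real ^ 'd) pmf" where
  "zo_output samp \<mu> n f \<psi> \<eta> b S m x0 =
     map_pmf (\<lambda>(B, s, t). zo_iterate \<mu> n f \<psi> \<eta> m x0 B s t)
       (pair_pmf (batches_pmf samp n b S m) (pmf_of_set ({1..S} \<times> {1..m})))"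

end

theory Submission
  imports Defs
begin

text \<open>
  One inexact proximal step decreases the objective by a multiple of the squared gradient mapping and
  of the squared step length, up to \<open>\<eta> / 2\<close> times the squared error of the gradient estimate. That
  error splits into the bias of the finite differences, of order \<open>L\<^sup>2 d \<mu>\<^sup>2\<close>, and the mini-batch error,
  whose second moment is at most \<open>L\<^sup>2 d / b\<close> times the squared distance to the reference point. Over
  an inner loop the squared distances sum to at most \<open>m\<^sup>2 / 2\<close> times the sum of the squared step
  lengths, so the condition on \<open>b\<close> lets the step-length terms absorb the mini-batch error directly,
  and the remaining inequality telescopes over all iterations.
\<close>

subsection \<open>Smooth functions and the coordinate-wise gradient estimator\<close>

text \<open>The link between an inexact step and the gradient mapping is a point that the algorithm
  never computes: the exact proximal point from the same iterate. The computed point is compared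
  with it, and it is compared with the iterate. Young's inequality with weight exactly \<eta>,
  applied to the inner product carrying the gradient error, cancels the distance between the two
  proximal points; what remains on the squared gradient mapping is the coefficient
  \<open>\<eta> / 2 - L * \<eta>\<^sup>2\<close>. No filtration is set up. All mini-batches are
  drawn at once from a finitely supported product distribution, so integrability is automatic, and
  conditioning on the past becomes averaging over one coordinate on which the current iterate does
  not depend. Differentiability is part of \<open>L_smooth\<close> because \<open>gradient\<close>
  is a definite description: its values are also Lipschitz, being constant, for a nowhere
  differentiable function.\<close>

definition L_smooth :: "real \<Rightarrow> ('a::real_inner \<Rightarrow> real) \<Rightarrow> bool" where
  "L_smooth L h \<longleftrightarrow> (\<forall>x. h differentiable (at x)) \<and>
     (\<forall>x y. norm (gradient h x - gradient h y) \<le> L * norm (x - y))"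

lemma gradient_eqI:
  fixes h :: "'a::real_inner \<Rightarrow> real"
  assumes "GDERIV h x :> D"
  shows "gradient h x = D"
  unfolding gradient_def
proof (rule the_equality)
  fix E assume "GDERIV h x :> E"
  then have "(\<lambda>v. v \<bullet> E) = (\<lambda>v. v \<bullet> D)"
    using assms unfolding gderiv_def by (rule has_derivative_unique)
  then have "(E - D) \<bullet> (E - D) = 0"
    by (simp add: inner_diff_right fun_eq_iff)
  then show "E = D"
    by simp
qed (rule assms)

text \<open>In finite dimension the vector assembled from the values of the derivative on the basis
  represents it as an inner product.\<close>

lemma GDERIV_gradient:
  fixes h :: "'a::euclidean_space \<Rightarrow> real"
  assumes "h differentiable (at x)"
  shows "GDERIV h x :> gradient h x"
proof -
  obtain h' where h': "(h has_derivative h') (at x)"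
    using assms by (auto simp: differentiable_def)
  define D where "D = (\<Sum>e\<in>Basis. h' e *\<^sub>R e)"
  have "h' v = v \<bullet> D" for v
  proof -
    have lin: "linear h'"
      using h' by (rule has_derivative_linear)
    have "h' v = h' (\<Sum>e\<in>Basis. (v \<bullet> e) *\<^sub>R e)"
      by (simp add: euclidean_representation)
    also have "\<dots> = (\<Sum>e\<in>Basis. (v \<bullet> e) * h' e)"
      by (simp add: linear_sum[OF lin] linear_cmul[OF lin])
    also have "\<dots> = v \<bullet> D"
      by (simp add: D_def inner_sum_right mult.commute)
    finally show ?thesis .
  qed
  then have "GDERIV h x :> D"
    using h' unfolding gderiv_def by (metis ext)
  then show ?thesis
    using gradient_eqI by blast
qed

lemma DERIV_along_line:
  fixes h :: "'a::euclidean_space \<Rightarrow> real"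
  assumes "h differentiable (at (x + s *\<^sub>R v))"
  shows "((\<lambda>s. h (x + s *\<^sub>R v)) has_real_derivative gradient h (x + s *\<^sub>R v) \<bullet> v) (at s)"
proof -
  have "(h has_derivative (\<lambda>w. w \<bullet> gradient h (x + s *\<^sub>R v))) (at (x + s *\<^sub>R v))"
    using GDERIV_gradient[OF assms] by (simp add: gderiv_def)
  moreover have "((\<lambda>s. x + s *\<^sub>R v) has_derivative (\<lambda>t. t *\<^sub>R v)) (at s)"
    by (auto intro!: derivative_eq_intros)
  ultimately have "((\<lambda>s. h (x + s *\<^sub>R v)) has_derivative
      (\<lambda>t. (t *\<^sub>R v) \<bullet> gradient h (x + s *\<^sub>R v))) (at s)"
    by (rule has_derivative_compose[rotated])
  then show ?thesis
    by (simp add: has_field_derivative_def inner_commute mult_commute_abs)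
qed

lemma L_smooth_upper:
  fixes h :: "'a::euclidean_space \<Rightarrow> real"
  assumes "L_smooth L h"
  shows "h y \<le> h x + gradient h x \<bullet> (y - x) + L / 2 * (norm (y - x))\<^sup>2"
proof -
  define v where "v = y - x"
  \<comment> \<open>The gap between \<open>h\<close> and its quadratic model along the segment: the
    Lipschitz bound makes its derivative nonpositive, and comparing the endpoints is the
    claim.\<close>
  define \<phi> where "\<phi> = (\<lambda>s. h (x + s *\<^sub>R v) - s * (gradient h x \<bullet> v) - s\<^sup>2 * (L / 2 * (norm v)\<^sup>2))"
  have "\<phi> 1 \<le> \<phi> 0"
  proof (rule DERIV_nonpos_imp_nonincreasing[of 0 1 \<phi>])
    fix s :: real assume s: "0 \<le> s" "s \<le> 1"
    have h: "h differentiable (at z)" for z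
      using assms by (simp add: L_smooth_def)
    let ?D = "gradient h (x + s *\<^sub>R v) \<bullet> v - gradient h x \<bullet> v - s * (L * (norm v)\<^sup>2)"
    have "(\<phi> has_real_derivative ?D) (at s)"
      unfolding \<phi>_def using DERIV_along_line[OF h]
      by (auto intro!: derivative_eq_intros)
    moreover have "?D \<le> 0"
    proof -
      have "(gradient h (x + s *\<^sub>R v) - gradient h x) \<bullet> v
          \<le> norm (gradient h (x + s *\<^sub>R v) - gradient h x) * norm v"
        by (rule norm_cauchy_schwarz)
      also have "\<dots> \<le> (L * norm (s *\<^sub>R v)) * norm v"
        using assms unfolding L_smooth_def
        by (metis add_diff_cancel_left' mult_right_mono norm_ge_zero)
      also have "\<dots> = s * (L * (norm v)\<^sup>2)"
        using s by (simp add: power2_eq_square)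
      finally show ?thesis
        by (simp add: inner_diff_left)
    qed
    ultimately show "\<exists>D. (\<phi> has_real_derivative D) (at s) \<and> D \<le> 0"
      by blast
  qed simp
  then show ?thesis
    by (simp add: \<phi>_def v_def algebra_simps)
qed

text \<open>Smoothness is symmetric under negation, so the lower quadratic bound, which holds
  without convexity of \<open>h\<close>, is the upper one for \<open>- h\<close>.\<close>

lemma L_smooth_uminus:
  fixes h :: "'a::euclidean_space \<Rightarrow> real"
  assumes "L_smooth L h"
  shows "L_smooth L (\<lambda>x. - h x)" and "gradient (\<lambda>x. - h x) x = - gradient h x"
proof -
  show *: "gradient (\<lambda>x. - h x) x = - gradient h x" for x
    using assms
    by (intro gradient_eqI GDERIV_minus GDERIV_gradient) (simp add: L_smooth_def)
  show "L_smooth L (\<lambda>x. - h x)"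
    using assms unfolding L_smooth_def *
    by (auto simp: norm_minus_commute)
qed

lemma L_smooth_lower:
  fixes h :: "'a::euclidean_space \<Rightarrow> real"
  assumes "L_smooth L h"
  shows "h x + gradient h x \<bullet> (y - x) - L / 2 * (norm (y - x))\<^sup>2 \<le> h y"
  using L_smooth_upper[OF L_smooth_uminus(1)[OF assms], of y x] L_smooth_uminus(2)[OF assms]
  by simp

lemma gradient_avg_loss:
  assumes "\<And>i. i \<in> {1..n} \<Longrightarrow> L_smooth L (f i)"
  shows "GDERIV (avg_loss n f) x :> (1 / real n) *\<^sub>R (\<Sum>i=1..n. gradient (f i) x)"
proof -
  have "GDERIV (f i) x :> gradient (f i) x" if "i \<in> {1..n}" for i
    using assms[OF that] by (intro GDERIV_gradient) (simp add: L_smooth_def)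
  then have "((\<lambda>x. (1 / real n) * (\<Sum>i=1..n. f i x)) has_derivative
      (\<lambda>v. (1 / real n) * (\<Sum>i=1..n. v \<bullet> gradient (f i) x))) (at x)"
    unfolding gderiv_def by (intro has_derivative_mult_right has_derivative_sum) auto
  then show ?thesis
    by (simp add: gderiv_def inner_sum_right avg_loss_def[abs_def])
qed

lemma L_smooth_avg_loss:
  assumes "\<And>i. i \<in> {1..n} \<Longrightarrow> L_smooth L (f i)" and "n \<ge> 1"
  shows "L_smooth L (avg_loss n f)"
  unfolding L_smooth_def
proof (intro conjI allI)
  fix x y
  show "avg_loss n f differentiable at x"
    using gradient_avg_loss[of n L f x] assms(1) unfolding gderiv_def differentiable_def by blast
  have eq: "gradient (avg_loss n f) z = (1 / real n) *\<^sub>R (\<Sum>i=1..n. gradient (f i) z)" for z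
    using gradient_avg_loss[OF assms(1)] by (intro gradient_eqI) 
  have "norm (gradient (avg_loss n f) x - gradient (avg_loss n f) y)
      = (1 / real n) * norm (\<Sum>i=1..n. gradient (f i) x - gradient (f i) y)"
    unfolding eq by (simp add: scaleR_diff_right[symmetric] sum_subtractf)
  also have "\<dots> \<le> (1 / real n) * (\<Sum>i=1..n. L * norm (x - y))"
    using assms(1) unfolding L_smooth_def
    by (intro mult_left_mono sum_norm_le) auto
  also have "\<dots> = L * norm (x - y)"
    using assms(2) by simp
  finally show "norm (gradient (avg_loss n f) x - gradient (avg_loss n f) y) \<le> L * norm (x - y)" .
qed

section \<open>Bias and Lipschitz constant of the coordinate-wise estimator\<close>

lemma coosge_nth:
  "coosge \<mu> h x $ j = (h (x + \<mu> *\<^sub>R axis j 1) - h (x - \<mu> *\<^sub>R axis j 1)) / (2 * \<mu>)"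
  by (simp add: coosge_def axis_def if_distrib cong: if_cong)

lemma norm_sq_le_of_components:
  fixes v :: "real ^ 'd"
  assumes "\<And>j. \<bar>v $ j\<bar> \<le> K"
  shows "(norm v)\<^sup>2 \<le> real CARD('d) * K\<^sup>2"
proof -
  have "(norm v)\<^sup>2 = (\<Sum>j\<in>UNIV. (v $ j)\<^sup>2)"
    by (simp add: norm_vec_def L2_set_def sum_nonneg)
  also have "\<dots> \<le> (\<Sum>j\<in>(UNIV::'d set). K\<^sup>2)"
    using assms by (intro sum_mono) (metis abs_le_square_iff abs_of_nonneg abs_ge_zero order_trans)
  finally show ?thesis
    by simp
qed

text \<open>In the central difference the values at \<open>x\<close> cancel and the linear terms add
  up to \<open>2 * \<mu>\<close> times the partial derivative. The two quadratic remainders amount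
  to at most \<open>L * \<mu>\<^sup>2\<close>, which division by \<open>2 * \<mu>\<close> turns into
  \<open>L * \<mu> / 2\<close> per coordinate.\<close>

lemma coosge_error:
  fixes h :: "real ^ 'd \<Rightarrow> real"
  assumes "L_smooth L h" and "\<mu> > 0"
  shows "(norm (coosge \<mu> h x - gradient h x))\<^sup>2 \<le> real CARD('d) * (L * \<mu> / 2)\<^sup>2"
proof (rule norm_sq_le_of_components)
  fix j :: 'd
  let ?e = "\<mu> *\<^sub>R axis j 1 :: real ^ 'd"
  have g: "gradient h x \<bullet> ?e = \<mu> * gradient h x $ j"
    by (simp add: inner_axis)
  have "h (x + ?e) \<le> h x + gradient h x \<bullet> ?e + L / 2 * \<mu>\<^sup>2"
    "h x + gradient h x \<bullet> ?e - L / 2 * \<mu>\<^sup>2 \<le> h (x + ?e)"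
    "h (x - ?e) \<le> h x - gradient h x \<bullet> ?e + L / 2 * \<mu>\<^sup>2"
    "h x - gradient h x \<bullet> ?e - L / 2 * \<mu>\<^sup>2 \<le> h (x - ?e)"
    using L_smooth_upper[OF assms(1), of "x + ?e" x] L_smooth_lower[OF assms(1), of x "x + ?e"]
      L_smooth_upper[OF assms(1), of "x - ?e" x] L_smooth_lower[OF assms(1), of x "x - ?e"]
    by (simp_all add: power_mult_distrib)
  then have "\<bar>h (x + ?e) - h (x - ?e) - 2 * \<mu> * gradient h x $ j\<bar> \<le> L * \<mu>\<^sup>2"
    unfolding g by (simp add: abs_le_iff)
  then have "\<bar>h (x + ?e) - h (x - ?e) - 2 * \<mu> * gradient h x $ j\<bar> / (2 * \<mu>) \<le> L * \<mu>\<^sup>2 / (2 * \<mu>)"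
    using assms(2) by (intro divide_right_mono) auto
  moreover have "\<bar>h (x + ?e) - h (x - ?e) - 2 * \<mu> * gradient h x $ j\<bar> / (2 * \<mu>)
      = \<bar>(h (x + ?e) - h (x - ?e) - 2 * \<mu> * gradient h x $ j) / (2 * \<mu>)\<bar>"
    using assms(2) by simp
  moreover have "(h (x + ?e) - h (x - ?e) - 2 * \<mu> * gradient h x $ j) / (2 * \<mu>)
      = (coosge \<mu> h x - gradient h x) $ j"
    using assms(2) by (simp add: coosge_nth diff_divide_distrib)
  moreover have "L * \<mu>\<^sup>2 / (2 * \<mu>) = L * \<mu> / 2"
    using assms(2) by (simp add: power2_eq_square)
  ultimately show "\<bar>(coosge \<mu> h x - gradient h x) $ j\<bar> \<le> L * \<mu> / 2"
    by simp
qed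

lemma coosge_Lipschitz:
  fixes h :: "real ^ 'd \<Rightarrow> real"
  assumes "L_smooth L h" and "\<mu> > 0"
  shows "(norm (coosge \<mu> h x - coosge \<mu> h y))\<^sup>2 \<le> real CARD('d) * (L * norm (x - y))\<^sup>2"
proof (rule norm_sq_le_of_components)
  fix j :: 'd
  let ?e = "axis j 1 :: real ^ 'd"
  \<comment> \<open>Applying the mean value theorem to the difference of the two lines, rather than
    to each line, gives one common parameter \<open>s\<close>. The two gradients are then taken at
    points that differ by exactly \<open>x - y\<close>, and \<mu> drops out of the bound.\<close>
  define \<phi> where "\<phi> = (\<lambda>s. h (x + s *\<^sub>R ?e) - h (y + s *\<^sub>R ?e))"
  have h: "h differentiable (at z)" for z
    using assms(1) by (simp add: L_smooth_def)
  have d: "(\<phi> has_real_derivative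
      gradient h (x + s *\<^sub>R ?e) \<bullet> ?e - gradient h (y + s *\<^sub>R ?e) \<bullet> ?e) (at s)" for s
    unfolding \<phi>_def by (intro DERIV_diff DERIV_along_line h)
  obtain s where s: "\<phi> \<mu> - \<phi> (- \<mu>) = (\<mu> - - \<mu>) *
      (gradient h (x + s *\<^sub>R ?e) \<bullet> ?e - gradient h (y + s *\<^sub>R ?e) \<bullet> ?e)"
    using MVT2[of "- \<mu>" \<mu> \<phi>, OF _ d] assms(2) by auto
  have "(coosge \<mu> h x - coosge \<mu> h y) $ j = (\<phi> \<mu> - \<phi> (- \<mu>)) / (2 * \<mu>)"
    by (simp add: coosge_nth \<phi>_def diff_divide_distrib)
  also have "\<dots> = (gradient h (x + s *\<^sub>R ?e) - gradient h (y + s *\<^sub>R ?e)) \<bullet> ?e"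
    using s assms(2) by (simp add: inner_diff_left)
  finally have "\<bar>(coosge \<mu> h x - coosge \<mu> h y) $ j\<bar>
      \<le> norm (gradient h (x + s *\<^sub>R ?e) - gradient h (y + s *\<^sub>R ?e)) * norm ?e"
    using Cauchy_Schwarz_ineq2 by metis
  also have "\<dots> \<le> L * norm (x - y)"
    using assms(1) unfolding L_smooth_def by (simp, metis add_diff_cancel_right)
  finally show "\<bar>(coosge \<mu> h x - coosge \<mu> h y) $ j\<bar> \<le> L * norm (x - y)" .
qed

subsection \<open>The proximal operator\<close>

text \<open>Continuity bounds \<psi> by \<open>K\<close> on the closed unit ball about
  \<open>x\<close>. For a distant \<open>y\<close>, the point of the segment at distance 1 from
  \<open>x\<close> is a convex combination of the ends, so convexity lets \<psi> fall at most
  linearly. This makes the objective of \<open>prox\<close> coercive.\<close>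

lemma convex_on_linear_lower_bound:
  fixes \<psi> :: "'a::euclidean_space \<Rightarrow> real"
  assumes "convex_on UNIV \<psi>"
  shows "\<exists>K\<ge>0. \<psi> x \<le> K \<and> (\<forall>y. norm (y - x) \<ge> 1 \<longrightarrow> - 2 * K * norm (y - x) \<le> \<psi> y)"
proof -
  have "continuous_on UNIV \<psi>"
    using assms by (intro convex_on_continuous) auto
  then have "compact (\<psi> ` cball x 1)"
    by (intro compact_continuous_image) (auto intro: continuous_on_subset)
  then have "bounded (\<psi> ` cball x 1)"
    by (rule compact_imp_bounded)
  then obtain K where "\<forall>u\<in>cball x 1. \<bar>\<psi> u\<bar> \<le> K"
    unfolding bounded_iff by auto
  then have K: "\<And>u. u \<in> cball x 1 \<Longrightarrow> \<bar>\<psi> u\<bar> \<le> K"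
    by blast
  then have K0: "\<bar>\<psi> x\<bar> \<le> K"
    by simp
  have "- 2 * K * norm (y - x) \<le> \<psi> y" if r: "norm (y - x) \<ge> 1" for y
  proof -
    define r where "r = norm (y - x)"
    define u where "u = (1 - 1 / r) *\<^sub>R x + (1 / r) *\<^sub>R y"
    have r1: "r \<ge> 1" using r r_def by simp
    have "u = x + (1 / r) *\<^sub>R (y - x)"
      by (simp add: u_def algebra_simps)
    then have "dist x u \<le> 1"
      using r1 by (simp add: dist_norm r_def[symmetric])
    then have "\<bar>\<psi> u\<bar> \<le> K"
      using K by simp
    moreover have "\<psi> u \<le> (1 - 1 / r) * \<psi> x + (1 / r) * \<psi> y"
      unfolding u_def using r1 by (intro convex_onD[OF assms]) auto
    ultimately have "- K \<le> (1 - 1 / r) * \<psi> x + (1 / r) * \<psi> y"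
      by linarith
    then have "r * - K \<le> r * ((1 - 1 / r) * \<psi> x + (1 / r) * \<psi> y)"
      using r1 by (intro mult_left_mono) auto
    also have "\<dots> = (r - 1) * \<psi> x + \<psi> y"
      using r1 by (simp add: field_simps)
    also have "(r - 1) * \<psi> x \<le> (r - 1) * K"
      using r1 K0 by (intro mult_left_mono) auto
    also have "\<dots> \<le> r * K"
      using K0 by (simp add: algebra_simps)
    finally show ?thesis
      by (simp add: r_def algebra_simps)
  qed
  then show ?thesis
    using K0 by (intro exI[of _ K]) auto
qed

text \<open>An \<open>ARG_MIN\<close> has its intended meaning only once a minimiser exists. Far
  from \<open>x\<close> the quadratic outweighs the linear lower bound on \<psi>; on the remaining
  ball compactness provides a minimiser.\<close>

lemma prox_minimal:
  fixes \<psi> :: "real ^ 'd \<Rightarrow> real"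
  assumes "convex_on UNIV \<psi>" and "\<eta> > 0"
  shows "\<psi> (prox \<eta> \<psi> x) + 1 / (2 * \<eta>) * (norm (prox \<eta> \<psi> x - x))\<^sup>2
    \<le> \<psi> y + 1 / (2 * \<eta>) * (norm (y - x))\<^sup>2"
proof -
  define q where "q = (\<lambda>y. \<psi> y + 1 / (2 * \<eta>) * (norm (y - x))\<^sup>2)"
  obtain K where K: "K \<ge> 0" "\<psi> x \<le> K"
    "\<And>y. norm (y - x) \<ge> 1 \<Longrightarrow> - 2 * K * norm (y - x) \<le> \<psi> y"
    using convex_on_linear_lower_bound[OF assms(1), of x] by auto
  \<comment> \<open>Chosen so that \<open>R / (2 * \<eta>) - 2 * K \<ge> K\<close>: at distance at
    least \<open>R\<close> the quadratic minus the linear loss is at least \<open>K\<close>, hence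
    at least \<open>\<psi> x\<close>, which is \<open>q x\<close>.\<close>
  define R where "R = 6 * \<eta> * K + 1"
  have R1: "R \<ge> 1"
    using K assms by (simp add: R_def)
  have outside: "q x \<le> q y" if "norm (y - x) \<ge> R" for y
  proof -
    define r where "r = norm (y - x)"
    have r: "r \<ge> 1" "r \<ge> R"
      using R1 that by (auto simp: r_def)
    have "K \<le> r * K"
      using r K by (simp add: mult_le_cancel_right1)
    also have "\<dots> \<le> r * (R / (2 * \<eta>) - 2 * K)"
      using r assms K by (intro mult_left_mono) (auto simp: R_def field_simps)
    also have "\<dots> \<le> r * (r / (2 * \<eta>) - 2 * K)"
      using r assms by (intro mult_left_mono diff_right_mono divide_right_mono) auto
    also have "\<dots> = - 2 * K * r + 1 / (2 * \<eta>) * r\<^sup>2"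
      by (simp add: power2_eq_square algebra_simps)
    also have "\<dots> \<le> q y"
      using K(3)[of y] r by (simp add: q_def r_def)
    finally show ?thesis
      using K(2) by (simp add: q_def)
  qed
  have "continuous_on UNIV \<psi>"
    using assms by (intro convex_on_continuous) auto
  then have "continuous_on (cball x R) \<psi>"
    by (rule continuous_on_subset) simp
  then have "continuous_on (cball x R) q"
    unfolding q_def by (intro continuous_intros)
  then obtain p where p: "p \<in> cball x R" "\<And>y. y \<in> cball x R \<Longrightarrow> q p \<le> q y"
    using continuous_attains_inf[of "cball x R" q] R1 by auto
  have "q p \<le> q y" for y
  proof (cases "y \<in> cball x R")
    case False
    then have "q x \<le> q y"
      by (intro outside) (simp add: dist_norm norm_minus_commute)
    moreover have "q p \<le> q x"
      using p R1 by simp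
    ultimately show ?thesis
      by simp
  qed (rule p)
  then have "q (arg_min q (\<lambda>_. True)) = q p"
    by (intro arg_min_equality) auto
  then have "q (prox \<eta> \<psi> x) = q p"
    by (simp add: prox_def q_def)
  with \<open>q p \<le> q y\<close> show ?thesis
    by (simp add: q_def)
qed

text \<open>Comparing the minimiser \<open>p\<close> with \<open>p + \<lambda> (z - p)\<close> and letting \<open>\<lambda>\<close> tend to \<open>0\<close> yields the
  extra quadratic term.\<close>

lemma prox_three_point:
  fixes \<psi> :: "real ^ 'd \<Rightarrow> real" and x z :: "real ^ 'd"
  assumes "convex_on UNIV \<psi>" and "\<eta> > 0"
  defines "p \<equiv> prox \<eta> \<psi> x"
  shows "\<psi> p + 1 / (2 * \<eta>) * (norm (p - x))\<^sup>2 + 1 / (2 * \<eta>) * (norm (p - z))\<^sup>2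
    \<le> \<psi> z + 1 / (2 * \<eta>) * (norm (z - x))\<^sup>2"
proof -
  define k where "k = 1 / (2 * \<eta>)"
  have ineq: "\<psi> p + k * (norm (p - x))\<^sup>2 + (1 - l) * (k * (norm (p - z))\<^sup>2)
      \<le> \<psi> z + k * (norm (z - x))\<^sup>2" if l: "0 < l" "l < 1" for l
  proof -
    let ?y = "(1 - l) *\<^sub>R p + l *\<^sub>R z"
    \<comment> \<open>The exact defect of convexity of the squared norm on a segment. Its factor
      \<open>l * (1 - l)\<close> still has \<open>1 - l\<close> left after division by
      \<open>l\<close>, and this survives the limit.\<close>
    have "(norm (?y - x))\<^sup>2
        = (1 - l) * (norm (p - x))\<^sup>2 + l * (norm (z - x))\<^sup>2 - l * (1 - l) * (norm (p - z))\<^sup>2"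
      unfolding power2_norm_eq_inner
      by (simp add: inner_diff_left inner_diff_right inner_add_left inner_add_right inner_commute
          algebra_simps)
    moreover have "\<psi> p + k * (norm (p - x))\<^sup>2 \<le> \<psi> ?y + k * (norm (?y - x))\<^sup>2"
      unfolding p_def k_def by (rule prox_minimal[OF assms(1,2)])
    moreover have "\<psi> ?y \<le> (1 - l) * \<psi> p + l * \<psi> z"
      using l by (intro convex_onD[OF assms(1)]) auto
    ultimately have "\<psi> p + k * (norm (p - x))\<^sup>2 \<le> (1 - l) * \<psi> p + l * \<psi> z
      + k * ((1 - l) * (norm (p - x))\<^sup>2 + l * (norm (z - x))\<^sup>2 - l * (1 - l) * (norm (p - z))\<^sup>2)"
      by simp
    then have "l * (\<psi> p + k * (norm (p - x))\<^sup>2 + (1 - l) * (k * (norm (p - z))\<^sup>2))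
      \<le> l * (\<psi> z + k * (norm (z - x))\<^sup>2)"
      by (simp add: algebra_simps)
    then show ?thesis
      using l by simp
  qed
  have "((\<lambda>l. \<psi> p + k * (norm (p - x))\<^sup>2 + (1 - l) * (k * (norm (p - z))\<^sup>2)) \<longlongrightarrow>
      \<psi> p + k * (norm (p - x))\<^sup>2 + (1 - 0) * (k * (norm (p - z))\<^sup>2)) (at_right 0)"
    by (intro tendsto_intros)
  moreover have "\<forall>\<^sub>F l in at_right 0. \<psi> p + k * (norm (p - x))\<^sup>2
      + (1 - l) * (k * (norm (p - z))\<^sup>2) \<le> \<psi> z + k * (norm (z - x))\<^sup>2"
    unfolding eventually_at_right_field using ineq by (intro exI[of _ 1]) auto
  ultimately show ?thesis
    unfolding k_def by (simp add: tendsto_upperbound)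
qed

text \<open>The three-point inequality, the quadratic upper bound at \<open>y\<close> and the lower
  bound at \<open>z\<close> are added; the \<open>norm v\<close> terms cancel. The reference point
  \<open>z\<close> stays free because two choices are needed: \<open>z = x\<close> gives sufficient
  decrease, and the exact proximal point as \<open>z\<close> measures an inexact step against the
  exact one.\<close>

lemma prox_step_inequality:
  fixes h \<psi> :: "real ^ 'd \<Rightarrow> real" and x v :: "real ^ 'd"
  assumes "L_smooth L h" and "convex_on UNIV \<psi>" and "\<eta> > 0"
  defines "y \<equiv> prox \<eta> \<psi> (x - \<eta> *\<^sub>R v)"
  shows "h y + \<psi> y \<le> h z + \<psi> z + (y - z) \<bullet> (gradient h x - v)
    + (L / 2 - 1 / (2 * \<eta>)) * (norm (y - x))\<^sup>2
    + (L / 2 + 1 / (2 * \<eta>)) * (norm (z - x))\<^sup>2 - 1 / (2 * \<eta>) * (norm (y - z))\<^sup>2"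
proof -
  have shift: "1 / (2 * \<eta>) * (norm (w - (x - \<eta> *\<^sub>R v)))\<^sup>2
      = 1 / (2 * \<eta>) * (norm (w - x))\<^sup>2 + (w - x) \<bullet> v + \<eta> / 2 * (norm v)\<^sup>2" for w
  proof -
    have "(norm (w - (x - \<eta> *\<^sub>R v)))\<^sup>2
        = (norm (w - x))\<^sup>2 + 2 * \<eta> * ((w - x) \<bullet> v) + \<eta>\<^sup>2 * (norm v)\<^sup>2"
      unfolding power2_norm_eq_inner
      by (simp add: inner_diff_left inner_diff_right inner_add_left inner_add_right inner_commute
          algebra_simps power2_eq_square)
    then show ?thesis
      using assms(3) by (simp add: field_simps power2_eq_square)
  qed
  have "\<psi> y + (1 / (2 * \<eta>) * (norm (y - x))\<^sup>2 + (y - x) \<bullet> v + \<eta> / 2 * (norm v)\<^sup>2)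
      + 1 / (2 * \<eta>) * (norm (y - z))\<^sup>2
      \<le> \<psi> z + (1 / (2 * \<eta>) * (norm (z - x))\<^sup>2 + (z - x) \<bullet> v + \<eta> / 2 * (norm v)\<^sup>2)"
    using prox_three_point[OF assms(2,3), of "x - \<eta> *\<^sub>R v" z]
    unfolding shift y_def[symmetric] by simp
  moreover have "h y \<le> h x + gradient h x \<bullet> (y - x) + L / 2 * (norm (y - x))\<^sup>2"
    by (rule L_smooth_upper[OF assms(1)])
  moreover have "h x + gradient h x \<bullet> (z - x) - L / 2 * (norm (z - x))\<^sup>2 \<le> h z"
    by (rule L_smooth_lower[OF assms(1)])
  moreover have "gradient h x \<bullet> (y - x) - gradient h x \<bullet> (z - x) + (z - x) \<bullet> v - (y - x) \<bullet> v
      = (y - z) \<bullet> (gradient h x - v)"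
    by (simp add: inner_diff_left inner_diff_right inner_commute)
  ultimately show ?thesis
    unfolding ring_distribs left_diff_distrib by linarith
qed

lemma norm_gradient_mapping:
  assumes "\<eta> > 0"
  shows "(norm (prox \<eta> \<psi> (x - \<eta> *\<^sub>R gradient h x) - x))\<^sup>2
    = \<eta>\<^sup>2 * (norm (gradient_mapping \<eta> h \<psi> x))\<^sup>2"
  using assms by (simp add: gradient_mapping_def power_mult_distrib power_divide norm_minus_commute)

text \<open>One exact proximal step from \<open>x\<close> lowers the objective by
  \<open>\<eta> - L / 2 * \<eta>\<^sup>2\<close> times the squared gradient mapping, and it cannot
  go below the optimum.\<close>

lemma gradient_mapping_le_gap:
  fixes h \<psi> :: "real ^ 'd \<Rightarrow> real"
  assumes "L_smooth L h" and "convex_on UNIV \<psi>" and "\<eta> > 0" and "L \<ge> 0"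
    and opt: "\<And>x. h xstar + \<psi> xstar \<le> h x + \<psi> x"
  shows "(\<eta> / 2 - L * \<eta>\<^sup>2) * (norm (gradient_mapping \<eta> h \<psi> x))\<^sup>2
    \<le> (h x + \<psi> x) - (h xstar + \<psi> xstar)"
proof -
  define G where "G = (norm (gradient_mapping \<eta> h \<psi> x))\<^sup>2"
  let ?y = "prox \<eta> \<psi> (x - \<eta> *\<^sub>R gradient h x)"
  have "h xstar + \<psi> xstar \<le> h ?y + \<psi> ?y"
    by (rule opt)
  also have "\<dots> \<le> h x + \<psi> x + (L / 2 - 1 / (2 * \<eta>)) * (\<eta>\<^sup>2 * G) - 1 / (2 * \<eta>) * (\<eta>\<^sup>2 * G)"
    using prox_step_inequality[OF assms(1-3), of x "gradient h x" x]
    unfolding norm_gradient_mapping[OF assms(3)] G_def by simp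
  also have "\<dots> = h x + \<psi> x - (\<eta> - L / 2 * \<eta>\<^sup>2) * G"
    using assms(3) by (simp add: field_simps power2_eq_square)
  also have "\<dots> \<le> h x + \<psi> x - (\<eta> / 2 - L * \<eta>\<^sup>2) * G"
  proof -
    \<comment> \<open>Weakened to the coefficient that the inexact steps produce, so that the last
      iterate can join their sum with equal weight.\<close>
    have "\<eta> / 2 - L * \<eta>\<^sup>2 \<le> \<eta> - L / 2 * \<eta>\<^sup>2"
      using assms(3,4) by (simp add: field_simps add_increasing)
    then have "(\<eta> / 2 - L * \<eta>\<^sup>2) * G \<le> (\<eta> - L / 2 * \<eta>\<^sup>2) * G"
      by (rule mult_right_mono) (simp add: G_def)
    then show ?thesis by simp
  qed
  finally show ?thesis by (simp add: G_def)
qed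

lemma inexact_prox_step_descent:
  fixes h \<psi> :: "real ^ 'd \<Rightarrow> real" and x v :: "real ^ 'd"
  assumes "L_smooth L h" and "convex_on UNIV \<psi>" and "\<eta> > 0"
  defines "y \<equiv> prox \<eta> \<psi> (x - \<eta> *\<^sub>R v)"
  shows "h y + \<psi> y + (\<eta> / 2 - L * \<eta>\<^sup>2) * (norm (gradient_mapping \<eta> h \<psi> x))\<^sup>2
      + (1 / (2 * \<eta>) - L / 2) * (norm (y - x))\<^sup>2
    \<le> h x + \<psi> x + \<eta> / 2 * (norm (gradient h x - v))\<^sup>2"
proof -
  define G where "G = (norm (gradient_mapping \<eta> h \<psi> x))\<^sup>2"
  define z where "z = prox \<eta> \<psi> (x - \<eta> *\<^sub>R gradient h x)"
  have z: "(norm (z - x))\<^sup>2 = \<eta>\<^sup>2 * G"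
    unfolding z_def G_def by (rule norm_gradient_mapping[OF assms(3)])
  have "h z + \<psi> z \<le> h x + \<psi> x + (L / 2 - 1 / (2 * \<eta>)) * (\<eta>\<^sup>2 * G) - 1 / (2 * \<eta>) * (\<eta>\<^sup>2 * G)"
    using prox_step_inequality[OF assms(1-3), of x "gradient h x" x]
    unfolding z_def[symmetric] z by simp
  moreover have "h y + \<psi> y \<le> h z + \<psi> z + (y - z) \<bullet> (gradient h x - v)
    + (L / 2 - 1 / (2 * \<eta>)) * (norm (y - x))\<^sup>2
    + (L / 2 + 1 / (2 * \<eta>)) * (\<eta>\<^sup>2 * G) - 1 / (2 * \<eta>) * (norm (y - z))\<^sup>2"
    using prox_step_inequality[OF assms(1-3), of x v z] unfolding y_def[symmetric] z .
  moreover have "(y - z) \<bullet> (gradient h x - v)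
      \<le> 1 / (2 * \<eta>) * (norm (y - z))\<^sup>2 + \<eta> / 2 * (norm (gradient h x - v))\<^sup>2"
  proof -
    let ?w = "gradient h x - v"
    \<comment> \<open>Young's inequality as a square; scaling by \<eta> makes its first term equal
      to the \<open>norm (y - z)\<close> term subtracted in the comparison with
      \<open>z\<close>.\<close>
    have "0 \<le> 1 / (2 * \<eta>) * (norm ((y - z) - \<eta> *\<^sub>R ?w))\<^sup>2"
      using assms(3) by simp
    also have "(norm ((y - z) - \<eta> *\<^sub>R ?w))\<^sup>2
        = (norm (y - z))\<^sup>2 - 2 * \<eta> * ((y - z) \<bullet> ?w) + \<eta>\<^sup>2 * (norm ?w)\<^sup>2"
      unfolding power2_norm_eq_inner
      by (simp add: inner_diff_left inner_diff_right inner_commute algebra_simps power2_eq_square)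
    finally show ?thesis
      using assms(3) by (simp add: field_simps power2_eq_square)
  qed
  \<comment> \<open>The exact step contributes \<open>L / 2 * \<eta>\<^sup>2 - \<eta>\<close> and
    the comparison with it \<open>L / 2 * \<eta>\<^sup>2 + \<eta> / 2\<close>; hence the form of
    \<gamma>.\<close>
  moreover have "(L / 2 - 1 / (2 * \<eta>)) * (\<eta>\<^sup>2 * G) - 1 / (2 * \<eta>) * (\<eta>\<^sup>2 * G)
      + (L / 2 + 1 / (2 * \<eta>)) * (\<eta>\<^sup>2 * G) = - ((\<eta> / 2 - L * \<eta>\<^sup>2) * G)"
    using assms(3) by (simp add: field_simps power2_eq_square)
  moreover have "(L / 2 - 1 / (2 * \<eta>)) * (norm (y - x))\<^sup>2
      = - ((1 / (2 * \<eta>) - L / 2) * (norm (y - x))\<^sup>2)"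
    by (simp add: algebra_simps)
  ultimately show ?thesis
    unfolding G_def[symmetric] by linarith
qed

subsection \<open>Finitely supported expectations\<close>

lemma expectation_pair_pmf_finite:
  fixes g :: "'a \<times> 'b \<Rightarrow> real"
  assumes "finite (set_pmf p)" and "finite (set_pmf q)"
  shows "measure_pmf.expectation (pair_pmf p q) g
    = measure_pmf.expectation p (\<lambda>x. measure_pmf.expectation q (\<lambda>y. g (x, y)))"
proof -
  have "measure_pmf.expectation (pair_pmf p q) g
      = measure_pmf.expectation (p \<bind> (\<lambda>x. map_pmf (Pair x) q)) g"
    by (simp add: pair_pmf_def map_pmf_def)
  also have "\<dots> = (\<Sum>x\<in>set_pmf p. pmf p x *\<^sub>R measure_pmf.expectation q (\<lambda>y. g (x, y)))"
    using assms by (subst pmf_expectation_bind[of "set_pmf p"]) auto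
  also have "\<dots> = measure_pmf.expectation p (\<lambda>x. measure_pmf.expectation q (\<lambda>y. g (x, y)))"
    using assms by (subst integral_measure_pmf[of "set_pmf p"]) auto
  finally show ?thesis .
qed

lemma expectation_mono_finite:
  fixes g h :: "'a \<Rightarrow> real"
  assumes "finite (set_pmf p)" and "\<And>x. x \<in> set_pmf p \<Longrightarrow> g x \<le> h x"
  shows "measure_pmf.expectation p g \<le> measure_pmf.expectation p h"
  using assms
  by (intro integral_mono_AE) (auto simp: AE_measure_pmf_iff integrable_measure_pmf_finite)

lemma finite_set_Pi_pmf:
  assumes "finite A" and "\<And>x. x \<in> A \<Longrightarrow> finite (set_pmf (p x))"
  shows "finite (set_pmf (Pi_pmf A dflt p))"
  using assms by (simp add: set_Pi_pmf finite_PiE_dflt)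

text \<open>This replaces conditional expectation. As \<open>X\<close> ignores coordinate
  \<open>a\<close>, the product splits into the other coordinates and \<open>a\<close>, and
  averaging over \<open>a\<close> first treats \<open>X B\<close> as a constant.\<close>

lemma expectation_Pi_pmf_fresh_le:
  fixes h :: "'b \<Rightarrow> 'c \<Rightarrow> real"
  assumes "finite A" and "a \<in> A" and fin: "\<And>x. x \<in> A \<Longrightarrow> finite (set_pmf (p x))"
    and fresh: "\<And>B y. X (B(a := y)) = X B"
    and le: "\<And>x. measure_pmf.expectation (p a) (\<lambda>y. h y x) \<le> H x"
  shows "measure_pmf.expectation (Pi_pmf A dflt p) (\<lambda>B. h (B a) (X B))
    \<le> measure_pmf.expectation (Pi_pmf A dflt p) (\<lambda>B. H (X B))"
proof -
  define Q where "Q = Pi_pmf (A - {a}) dflt p"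
  have split: "Pi_pmf A dflt p = map_pmf (\<lambda>(B, y). B(a := y)) (pair_pmf Q (p a))"
  proof -
    have "Pi_pmf A dflt p = map_pmf (\<lambda>(y, B). B(a := y)) (pair_pmf (p a) Q)"
      using Pi_pmf_insert[of "A - {a}" a dflt p] assms(1,2) by (simp add: insert_absorb Q_def)
    also have "\<dots> = map_pmf (\<lambda>(B, y). B(a := y)) (pair_pmf Q (p a))"
      by (subst pair_commute_pmf) (simp add: map_pmf_comp case_prod_unfold)
    finally show ?thesis .
  qed
  have finQ: "finite (set_pmf Q)" and fina: "finite (set_pmf (p a))"
    unfolding Q_def using assms by (auto intro!: finite_set_Pi_pmf)
  have expand: "measure_pmf.expectation (Pi_pmf A dflt p) g
      = measure_pmf.expectation Q (\<lambda>B. measure_pmf.expectation (p a) (\<lambda>y. g (B(a := y))))"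
    for g :: "('a \<Rightarrow> 'b) \<Rightarrow> real"
    unfolding split integral_map_pmf expectation_pair_pmf_finite[OF finQ fina] by simp
  have "measure_pmf.expectation (Pi_pmf A dflt p) (\<lambda>B. h (B a) (X B))
      = measure_pmf.expectation Q (\<lambda>B. measure_pmf.expectation (p a) (\<lambda>y. h y (X B)))"
    unfolding expand fresh by simp
  also have "\<dots> \<le> measure_pmf.expectation Q (\<lambda>B. H (X B))"
    using finQ le by (intro expectation_mono_finite)
  also have "\<dots> = measure_pmf.expectation (Pi_pmf A dflt p) (\<lambda>B. H (X B))"
    unfolding expand fresh by simp
  finally show ?thesis .
qed

subsection \<open>Variance of mini-batch averages\<close>

text \<open>Removing \<open>U\<close> is a bijection onto the subsets of \<open>V - U\<close> of the
  reduced size. The case distinction guards against truncated subtraction, under which the binomial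
  coefficient would be 1 instead of 0.\<close>

lemma card_subsets_containing:
  assumes "finite V" and "U \<subseteq> V"
  shows "card {A. A \<subseteq> V \<and> card A = k \<and> U \<subseteq> A}
    = (if card U \<le> k then (card V - card U) choose (k - card U) else 0)"
proof (cases "card U \<le> k")
  case True
  have U: "finite U" using assms finite_subset by blast
  have "bij_betw (\<lambda>A. A - U) {A. A \<subseteq> V \<and> card A = k \<and> U \<subseteq> A}
      {A. A \<subseteq> V - U \<and> card A = k - card U}"
  proof (rule bij_betw_byWitness[where f' = "\<lambda>A. A \<union> U"])
    show "(\<lambda>A. A \<union> U) ` {A. A \<subseteq> V - U \<and> card A = k - card U}
        \<subseteq> {A. A \<subseteq> V \<and> card A = k \<and> U \<subseteq> A}"
    proof safe
      fix A assume A: "A \<subseteq> V - U" "card A = k - card U"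
      then have "finite A" "A \<inter> U = {}"
        using assms(1) finite_subset[of A V] by auto
      then show "card (A \<union> U) = k"
        using A True U by (simp add: card_Un_disjoint)
    qed (use assms in auto)
  qed (use U in \<open>auto simp: card_Diff_subset\<close>)
  then have "card {A. A \<subseteq> V \<and> card A = k \<and> U \<subseteq> A} = card (V - U) choose (k - card U)"
    using bij_betw_same_card n_subsets[of "V - U"] assms(1) by fastforce
  then show ?thesis
    using True assms U by (simp add: card_Diff_subset)
next
  case False
  have "\<not> (A \<subseteq> V \<and> card A = k \<and> U \<subseteq> A)" for A
    using False assms(1) card_mono[of A U] finite_subset[of A V] by auto
  then have "{A. A \<subseteq> V \<and> card A = k \<and> U \<subseteq> A} = {}"
    by blast
  then show ?thesis
    using False by (simp only: card.empty if_False)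
qed

text \<open>After expanding the square, each index occurs in \<open>N1\<close> subsets and each pair
  of distinct indices in \<open>N2\<close>. Completing the off-diagonal part to \<open>N2\<close>
  times the squared norm of the total sum, which vanishes, leaves \<open>N1 - N2\<close> times the
  sum of squares.\<close>

lemma sum_subsets_norm_sq_le:
  fixes \<xi> :: "'i \<Rightarrow> 'a::real_inner"
  assumes "finite V" and zero: "(\<Sum>i\<in>V. \<xi> i) = 0" and "k \<ge> 1"
  shows "(\<Sum>A | A \<subseteq> V \<and> card A = k. (norm (\<Sum>i\<in>A. \<xi> i))\<^sup>2)
    \<le> real ((card V - 1) choose (k - 1)) * (\<Sum>i\<in>V. (norm (\<xi> i))\<^sup>2)"
proof -
  define N2 where "N2 = (if 2 \<le> k then (card V - 2) choose (k - 2) else 0)"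
  define N1 where "N1 = (card V - 1) choose (k - 1)"
  let ?P = "{A. A \<subseteq> V \<and> card A = k}"
  have finP: "finite ?P"
    using assms(1) by (rule finite_subset[rotated, OF finite_Pow_iff[THEN iffD2]]) auto
  have count: "(\<Sum>A\<in>?P. if i \<in> A \<and> j \<in> A then \<xi> i \<bullet> \<xi> j else 0)
      = real N2 * (\<xi> i \<bullet> \<xi> j) + (if i = j then (real N1 - real N2) * (norm (\<xi> i))\<^sup>2 else 0)"
    if "i \<in> V" "j \<in> V" for i j
  proof -
    have "(\<Sum>A\<in>?P. if i \<in> A \<and> j \<in> A then \<xi> i \<bullet> \<xi> j else 0)
        = real (card {A. A \<subseteq> V \<and> card A = k \<and> {i, j} \<subseteq> A}) * (\<xi> i \<bullet> \<xi> j)"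
      using finP by (simp add: sum.If_cases Int_def conj_assoc)
    also have "card {A. A \<subseteq> V \<and> card A = k \<and> {i, j} \<subseteq> A} = (if i = j then N1 else N2)"
      using card_subsets_containing[OF assms(1), of "{i, j}" k] that assms(3)
      by (auto simp: N1_def N2_def numeral_2_eq_2)
    finally show ?thesis
      by (simp add: power2_norm_eq_inner algebra_simps)
  qed
  have "(\<Sum>A\<in>?P. (norm (\<Sum>i\<in>A. \<xi> i))\<^sup>2)
      = (\<Sum>A\<in>?P. \<Sum>i\<in>V. \<Sum>j\<in>V. if i \<in> A \<and> j \<in> A then \<xi> i \<bullet> \<xi> j else 0)"
  proof (rule sum.cong)
    fix A assume "A \<in> ?P"
    then have "(\<Sum>i\<in>A. \<xi> i) = (\<Sum>i\<in>V. if i \<in> A then \<xi> i else 0)"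
      using assms(1) by (intro sum.mono_neutral_cong_left) auto
    then have "(norm (\<Sum>i\<in>A. \<xi> i))\<^sup>2
        = (\<Sum>i\<in>V. if i \<in> A then \<xi> i else 0) \<bullet> (\<Sum>j\<in>V. if j \<in> A then \<xi> j else 0)"
      by (simp add: power2_norm_eq_inner)
    also have "\<dots> = (\<Sum>i\<in>V. \<Sum>j\<in>V. if i \<in> A \<and> j \<in> A then \<xi> i \<bullet> \<xi> j else 0)"
      unfolding inner_sum_left inner_sum_right by (intro sum.cong) (auto simp: inner_commute)
    finally show "(norm (\<Sum>i\<in>A. \<xi> i))\<^sup>2 = \<dots>" .
  qed simp
  also have "\<dots> = (\<Sum>i\<in>V. \<Sum>j\<in>V. \<Sum>A\<in>?P. if i \<in> A \<and> j \<in> A then \<xi> i \<bullet> \<xi> j else 0)"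
    by (subst sum.swap) (intro sum.cong refl sum.swap)
  also have "\<dots> = (\<Sum>i\<in>V. \<Sum>j\<in>V. real N2 * (\<xi> i \<bullet> \<xi> j)
      + (if i = j then (real N1 - real N2) * (norm (\<xi> i))\<^sup>2 else 0))"
    by (intro sum.cong refl count)
  also have "\<dots> = real N2 * ((\<Sum>i\<in>V. \<xi> i) \<bullet> (\<Sum>j\<in>V. \<xi> j))
      + (real N1 - real N2) * (\<Sum>i\<in>V. (norm (\<xi> i))\<^sup>2)"
  proof -
    have "(\<Sum>i\<in>V. \<xi> i) \<bullet> (\<Sum>j\<in>V. \<xi> j) = (\<Sum>i\<in>V. \<Sum>j\<in>V. \<xi> i \<bullet> \<xi> j)"
      by (simp only: inner_sum_left) (simp only: inner_sum_right)
    then show ?thesis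
      using assms(1) by (simp add: sum.distrib sum_distrib_left)
  qed
  also have "\<dots> \<le> real N1 * (\<Sum>i\<in>V. (norm (\<xi> i))\<^sup>2)"
    by (simp add: zero mult_right_mono sum_nonneg)
  finally show ?thesis
    by (simp add: N1_def)
qed

text \<open>Each further draw adds the mean of the squared norms, since its cross term with the
  earlier draws averages to zero.\<close>

lemma expectation_replicate_norm_sq:
  fixes \<xi> :: "nat \<Rightarrow> 'a::real_inner"
  assumes zero: "(\<Sum>i=1..n. \<xi> i) = 0" and "n \<ge> 1"
  shows "measure_pmf.expectation (replicate_pmf k (pmf_of_set {1..n}))
      (\<lambda>xs. (norm (\<Sum>i\<leftarrow>xs. \<xi> i))\<^sup>2)
    = real k / real n * (\<Sum>i=1..n. (norm (\<xi> i))\<^sup>2)"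
proof (induction k)
  case (Suc k)
  let ?R = "replicate_pmf k (pmf_of_set {1..n})"
  have fin: "finite (set_pmf ?R)"
    using assms(2) by (simp add: set_replicate_pmf lists_eq_set finite_lists_length_eq)
  have "measure_pmf.expectation (replicate_pmf (Suc k) (pmf_of_set {1..n}))
        (\<lambda>xs. (norm (\<Sum>i\<leftarrow>xs. \<xi> i))\<^sup>2)
      = measure_pmf.expectation (pmf_of_set {1..n} \<bind> (\<lambda>x. map_pmf ((#) x) ?R))
        (\<lambda>xs. (norm (\<Sum>i\<leftarrow>xs. \<xi> i))\<^sup>2)"
    by (simp add: map_pmf_def)
  also have "\<dots> = (\<Sum>a=1..n. measure_pmf.expectation ?R
      (\<lambda>xs. (norm (\<xi> a + (\<Sum>i\<leftarrow>xs. \<xi> i)))\<^sup>2) /\<^sub>R real n)"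
    using assms(2) fin by (subst pmf_expectation_bind_pmf_of_set) auto
  also have "\<dots> = measure_pmf.expectation ?R
      (\<lambda>xs. \<Sum>a=1..n. (norm (\<xi> a + (\<Sum>i\<leftarrow>xs. \<xi> i)))\<^sup>2) / real n"
    using fin by (simp add: integrable_measure_pmf_finite sum_distrib_left divide_inverse mult.commute)
  also have "(\<lambda>xs. \<Sum>a=1..n. (norm (\<xi> a + (\<Sum>i\<leftarrow>xs. \<xi> i)))\<^sup>2)
      = (\<lambda>xs. (\<Sum>a=1..n. (norm (\<xi> a))\<^sup>2) + real n * (norm (\<Sum>i\<leftarrow>xs. \<xi> i))\<^sup>2)"
  proof
    fix xs
    have "(\<Sum>a=1..n. (norm (\<xi> a + S))\<^sup>2)
        = (\<Sum>a=1..n. (norm (\<xi> a))\<^sup>2) + 2 * ((\<Sum>a=1..n. \<xi> a) \<bullet> S) + real n * (norm S)\<^sup>2" for S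
      unfolding power2_norm_eq_inner
      by (simp add: inner_add_left inner_add_right inner_commute sum.distrib inner_sum_left
          inner_sum_right sum_distrib_left)
    then show "(\<Sum>a=1..n. (norm (\<xi> a + (\<Sum>i\<leftarrow>xs. \<xi> i)))\<^sup>2)
        = (\<Sum>a=1..n. (norm (\<xi> a))\<^sup>2) + real n * (norm (\<Sum>i\<leftarrow>xs. \<xi> i))\<^sup>2"
      unfolding zero by simp
  qed
  also have "measure_pmf.expectation ?R
      (\<lambda>xs. (\<Sum>a=1..n. (norm (\<xi> a))\<^sup>2) + real n * (norm (\<Sum>i\<leftarrow>xs. \<xi> i))\<^sup>2)
      = (\<Sum>a=1..n. (norm (\<xi> a))\<^sup>2) + real n * (real k / real n * (\<Sum>i=1..n. (norm (\<xi> i))\<^sup>2))"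
    using fin Suc.IH by (simp add: integrable_measure_pmf_finite)
  finally show ?case
    using assms(2) by (simp add: field_simps)
qed simp

lemma finite_card_subsets: "finite {A. A \<subseteq> {1..n :: nat} \<and> card A = b}"
  by (rule finite_subset[of _ "Pow {1..n}"]) auto

lemma card_subsets_nonempty:
  assumes "b \<le> n"
  shows "{A. A \<subseteq> {1..n :: nat} \<and> card A = b} \<noteq> {}"
  using assms by (auto intro!: exI[of _ "{1..b}"])

lemma finite_set_batch_pmf:
  assumes "n \<ge> 1" and "samp = Without_Replacement \<Longrightarrow> b \<le> n"
  shows "finite (set_pmf (batch_pmf samp n b))"
proof (cases samp)
  case With_Replacement
  then show ?thesis
    using assms(1) by (simp add: set_replicate_pmf lists_eq_set finite_lists_length_eq)
next
  case Without_Replacement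
  then show ?thesis
    using finite_card_subsets card_subsets_nonempty[of b n] assms(2) by simp
qed

lemma size_batch_pmf:
  assumes "n \<ge> 1" and "samp = Without_Replacement \<Longrightarrow> b \<le> n"
    and "I \<in> set_pmf (batch_pmf samp n b)"
  shows "size I = b"
proof (cases samp)
  case With_Replacement
  then show ?thesis
    using assms by (auto simp: set_replicate_pmf)
next
  case Without_Replacement
  then show ?thesis
    using finite_card_subsets[of n b] card_subsets_nonempty[of b n] assms(2,3)
    by (auto dest: finite_subset)
qed

lemma expectation_batch_norm_sq_le:
  fixes \<xi> :: "nat \<Rightarrow> 'a::real_inner"
  assumes "n \<ge> 1" and "b \<ge> 1" and bn: "samp = Without_Replacement \<Longrightarrow> b \<le> n"
    and zero: "(\<Sum>i=1..n. \<xi> i) = 0"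
  shows "measure_pmf.expectation (batch_pmf samp n b) (\<lambda>I. (norm (\<Sum>i\<in>#I. \<xi> i))\<^sup>2)
    \<le> real b / real n * (\<Sum>i=1..n. (norm (\<xi> i))\<^sup>2)"
proof (cases samp)
  case With_Replacement
  have "sum_mset (image_mset \<xi> (mset xs)) = (\<Sum>i\<leftarrow>xs. \<xi> i)" for xs
    by (simp flip: sum_mset_sum_list)
  then show ?thesis
    using With_Replacement expectation_replicate_norm_sq[OF zero assms(1), of b] by simp
next
  case Without_Replacement
  let ?P = "{A. A \<subseteq> {1..n} \<and> card A = b}"
  have fin: "finite ?P" and ne: "?P \<noteq> {}"
    using finite_card_subsets card_subsets_nonempty bn Without_Replacement by auto
  have card: "card ?P = n choose b"
    using n_subsets[of "{1..n}" b] by simp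
  have "measure_pmf.expectation (batch_pmf samp n b) (\<lambda>I. (norm (\<Sum>i\<in>#I. \<xi> i))\<^sup>2)
      = (\<Sum>A\<in>?P. (norm (\<Sum>i\<in>A. \<xi> i))\<^sup>2) / real (n choose b)"
  proof -
    have "(\<Sum>i\<in>#mset_set A. \<xi> i) = (\<Sum>i\<in>A. \<xi> i)" for A
      by (simp add: sum_unfold_sum_mset)
    then show ?thesis
      by (simp only: Without_Replacement batch_pmf.simps integral_map_pmf
          integral_pmf_of_set[OF ne fin] card)
  qed
  also have "\<dots> \<le> real ((n - 1) choose (b - 1)) * (\<Sum>i=1..n. (norm (\<xi> i))\<^sup>2) / real (n choose b)"
    using sum_subsets_norm_sq_le[of "{1..n}" \<xi> b] zero assms(2)
    by (intro divide_right_mono) auto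
  also have "\<dots> = real b / real n * (\<Sum>i=1..n. (norm (\<xi> i))\<^sup>2)"
  proof -
    \<comment> \<open>The ratio of the two binomials is the probability \<open>b / n\<close> that a
      fixed index lies in a uniform subset of size \<open>b\<close>, which matches the factor for
      independent draws.\<close>
    have "b * (n choose b) = n * ((n - 1) choose (b - 1))"
      using times_binomial_minus1_eq[of b n] assms(2) by simp
    then have "real b * real (n choose b) = real n * real ((n - 1) choose (b - 1))"
      by (metis of_nat_mult)
    moreover have "n choose b > 0"
      using bn Without_Replacement by (simp add: zero_less_binomial)
    ultimately show ?thesis
      using assms(1) by (simp add: field_simps)
  qed
  finally show ?thesis .
qed

text \<open>The centred vectors \<xi> sum to zero, so the bound for mini-batch sums applies, and
  division by \<open>b\<^sup>2\<close> turns \<open>b / n\<close> into \<open>1 / (b * n)\<close>.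
  Centring does not increase the sum of squares, which leads back to \<zeta>.\<close>

lemma expectation_batch_average_le:
  fixes \<zeta> :: "nat \<Rightarrow> 'a::real_inner"
  assumes "n \<ge> 1" and "b \<ge> 1" and bn: "samp = Without_Replacement \<Longrightarrow> b \<le> n"
  shows "measure_pmf.expectation (batch_pmf samp n b)
      (\<lambda>I. (norm ((1 / real (size I)) *\<^sub>R (\<Sum>i\<in>#I. \<zeta> i) - (1 / real n) *\<^sub>R (\<Sum>i=1..n. \<zeta> i)))\<^sup>2)
    \<le> 1 / (real b * real n) * (\<Sum>i=1..n. (norm (\<zeta> i))\<^sup>2)"
proof -
  define a where "a = (1 / real n) *\<^sub>R (\<Sum>i=1..n. \<zeta> i)"
  define \<xi> where "\<xi> i = \<zeta> i - a" for i
  have sum_\<zeta>: "(\<Sum>i=1..n. \<zeta> i) = real n *\<^sub>R a"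
    using assms(1) by (simp add: a_def)
  have zero: "(\<Sum>i=1..n. \<xi> i) = 0"
    unfolding \<xi>_def sum_subtractf sum_\<zeta> by (simp add: sum_constant_scaleR)
  have "(\<Sum>i=1..n. (norm (\<xi> i))\<^sup>2) = (\<Sum>i=1..n. (norm (\<zeta> i))\<^sup>2 - 2 * (\<zeta> i \<bullet> a) + (norm a)\<^sup>2)"
    unfolding \<xi>_def power2_norm_eq_inner
    by (intro sum.cong) (auto simp: inner_diff_left inner_diff_right inner_commute)
  also have "\<dots> = (\<Sum>i=1..n. (norm (\<zeta> i))\<^sup>2) - 2 * ((\<Sum>i=1..n. \<zeta> i) \<bullet> a) + real n * (norm a)\<^sup>2"
    by (simp add: sum.distrib sum_subtractf inner_sum_left sum_distrib_left)
  also have "\<dots> \<le> (\<Sum>i=1..n. (norm (\<zeta> i))\<^sup>2)"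
    unfolding sum_\<zeta> by (simp add: power2_norm_eq_inner)
  finally have \<xi>\<zeta>: "(\<Sum>i=1..n. (norm (\<xi> i))\<^sup>2) \<le> (\<Sum>i=1..n. (norm (\<zeta> i))\<^sup>2)" .
  have fin: "finite (set_pmf (batch_pmf samp n b))"
    by (rule finite_set_batch_pmf[OF assms(1) bn])
  have "measure_pmf.expectation (batch_pmf samp n b)
      (\<lambda>I. (norm ((1 / real (size I)) *\<^sub>R (\<Sum>i\<in>#I. \<zeta> i) - a))\<^sup>2)
      \<le> measure_pmf.expectation (batch_pmf samp n b) (\<lambda>I. (1 / (real b)\<^sup>2) * (norm (\<Sum>i\<in>#I. \<xi> i))\<^sup>2)"
  proof (rule expectation_mono_finite[OF fin])
    fix I assume "I \<in> set_pmf (batch_pmf samp n b)"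
    then have I: "size I = b"
      using size_batch_pmf[OF assms(1) bn] by blast
    have "(\<Sum>i\<in>#I. \<xi> i) = (\<Sum>i\<in>#I. \<zeta> i) - real (size I) *\<^sub>R a"
      by (induction I) (simp_all add: \<xi>_def algebra_simps)
    then have "(1 / real b) *\<^sub>R (\<Sum>i\<in>#I. \<xi> i) = (1 / real b) *\<^sub>R (\<Sum>i\<in>#I. \<zeta> i) - a"
      using I assms(2) by (simp add: scaleR_diff_right)
    then show "(norm ((1 / real (size I)) *\<^sub>R (\<Sum>i\<in>#I. \<zeta> i) - a))\<^sup>2
        \<le> (1 / (real b)\<^sup>2) * (norm (\<Sum>i\<in>#I. \<xi> i))\<^sup>2"
      unfolding I by (metis (no_types, lifting) I abs_of_nat norm_scaleR order_refl power_mult_distrib power_one_over abs_divide abs_one)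
  qed
  also have "\<dots> = (1 / (real b)\<^sup>2) * measure_pmf.expectation (batch_pmf samp n b)
      (\<lambda>I. (norm (\<Sum>i\<in>#I. \<xi> i))\<^sup>2)"
    by simp
  also have "\<dots> \<le> (1 / (real b)\<^sup>2) * (real b / real n * (\<Sum>i=1..n. (norm (\<zeta> i))\<^sup>2))"
    using expectation_batch_norm_sq_le[OF assms(1,2) bn zero] \<xi>\<zeta>
    by (intro mult_left_mono order_trans[OF expectation_batch_norm_sq_le[OF assms(1,2) bn zero]]) auto
  also have "\<dots> = 1 / (real b * real n) * (\<Sum>i=1..n. (norm (\<zeta> i))\<^sup>2)"
    using assms(2) by (simp add: field_simps power2_eq_square)
  finally show ?thesis
    unfolding a_def .
qed

subsection \<open>The iteration\<close>

lemma inner_iterate_cong: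
  assumes "\<And>k. k < t \<Longrightarrow> I k = J k"
  shows "inner_iterate \<mu> n f \<psi> \<eta> I x t = inner_iterate \<mu> n f \<psi> \<eta> J x t"
  using assms by (induction t) (simp_all add: Let_def)

lemma snapshot_fresh:
  assumes "s' \<le> s"
  shows "snapshot \<mu> n f \<psi> \<eta> m x0 (B((s, t) := I)) s' = snapshot \<mu> n f \<psi> \<eta> m x0 B s'"
  using assms
proof (induction s' rule: nat_less_induct)
  case (1 s')
  show ?case
  proof (cases s')
    case (Suc k)
    with 1 show ?thesis by (cases k) auto
  qed simp
qed

text \<open>The batch with index \<open>(s, t)\<close> first acts in the step from \<open>t\<close>
  to \<open>Suc t\<close>, so every iterate of the loop up to and including \<open>t\<close> is
  unaffected by it.\<close>

lemma zo_iterate_fresh: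
  assumes "t' \<le> t"
  shows "zo_iterate \<mu> n f \<psi> \<eta> m x0 (B((s, t) := I)) s t' = zo_iterate \<mu> n f \<psi> \<eta> m x0 B s t'"
  unfolding zo_iterate_def snapshot_fresh[OF order_refl]
  using assms by (intro inner_iterate_cong) auto

text \<open>The reference point is expressed as the iterate with index 0, so one freshness statement
  covers both arguments of \<open>vhat\<close>.\<close>

lemma zo_iterate_Suc:
  "zo_iterate \<mu> n f \<psi> \<eta> m x0 B s (Suc t) =
    prox \<eta> \<psi> (zo_iterate \<mu> n f \<psi> \<eta> m x0 B s t - \<eta> *\<^sub>R vhat \<mu> n f (B (s, t))
      (zo_iterate \<mu> n f \<psi> \<eta> m x0 B s t) (zo_iterate \<mu> n f \<psi> \<eta> m x0 B s 0))"
  by (simp add: zo_iterate_def Let_def)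

lemma zo_iterate_next_loop:
  assumes "s \<ge> 1"
  shows "zo_iterate \<mu> n f \<psi> \<eta> m x0 B (Suc s) 0 = zo_iterate \<mu> n f \<psi> \<eta> m x0 B s m"
  using assms by (cases s) (simp_all add: zo_iterate_def)

text \<open>Telescoping and Cauchy-Schwarz bound the \<open>t\<close>-th distance by
  \<open>t\<close> times the total of squared steps; the factor is the sum of all
  \<open>t < m\<close>.\<close>

lemma sum_norm_sq_from_start_le:
  fixes u :: "nat \<Rightarrow> 'a::real_normed_vector"
  shows "(\<Sum>t<m. (norm (u t - u 0))\<^sup>2) \<le> (real m)\<^sup>2 / 2 * (\<Sum>t<m. (norm (u (Suc t) - u t))\<^sup>2)"
proof -
  define D where "D = (\<Sum>t<m. (norm (u (Suc t) - u t))\<^sup>2)"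
  have D: "D \<ge> 0"
    by (simp add: D_def sum_nonneg)
  have "(\<Sum>t<m. (norm (u t - u 0))\<^sup>2) \<le> (\<Sum>t<m. real t * D)"
  proof (rule sum_mono)
    fix t assume t: "t \<in> {..<m}"
    have "norm (u t - u 0) \<le> (\<Sum>k<t. norm (u (Suc k) - u k))"
      by (metis sum_lessThan_telescope norm_sum)
    then have "(norm (u t - u 0))\<^sup>2 \<le> (\<Sum>k<t. norm (u (Suc k) - u k))\<^sup>2"
      by (intro power_mono) auto
    also have "\<dots> \<le> (\<Sum>k<t. (norm (u (Suc k) - u k))\<^sup>2) * real t"
      using sum_squared_le_sum_of_squares[of "\<lambda>k. norm (u (Suc k) - u k)" "{..<t}"] by simp
    also have "\<dots> \<le> D * real t"
      unfolding D_def using t by (intro mult_right_mono sum_mono2) auto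
    finally show "(norm (u t - u 0))\<^sup>2 \<le> real t * D"
      by (simp add: mult.commute)
  qed
  also have "\<dots> = (\<Sum>t<m. real t) * D"
    by (simp add: sum_distrib_right)
  also have "(\<Sum>t<m. real t) \<le> (real m)\<^sup>2 / 2"
    by (induction m) (auto simp: power2_eq_square field_simps)
  finally show ?thesis
    using D by (simp add: D_def mult_right_mono)
qed

text \<open>The last iterate of a loop is the first of the next, so moving every index range by one
  changes only the two outermost terms.\<close>

lemma sum_shift_loops:
  fixes a :: "nat \<Rightarrow> nat \<Rightarrow> real"
  assumes "\<And>s. s \<ge> 1 \<Longrightarrow> a (Suc s) 0 = a s m" and "S \<ge> 1"
  shows "(\<Sum>s=1..S. \<Sum>t=1..m. a s t) + a 1 0 = (\<Sum>s=1..S. \<Sum>t<m. a s t) + a S m"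
proof -
  have shift: "(\<Sum>t=1..m. g t) + g 0 = (\<Sum>t<m. g t) + g m" for g :: "nat \<Rightarrow> real"
    by (induction m) auto
  show ?thesis
    using assms(2)
  proof (induction S rule: nat_induct_at_least)
    case base
    show ?case
      using shift[of "a 1"] by simp
  next
    case (Suc s)
    with assms(1)[of s] shift[of "a (Suc s)"] show ?case
      by simp
  qed
qed

text \<open>The estimator is linear in the function. Hence the bias of the full estimate is that of
  a single smooth function, the average loss.\<close>

lemma coosge_full_eq: "coosge_full \<mu> n f x = coosge \<mu> (avg_loss n f) x"
  by (simp add: vec_eq_iff coosge_nth coosge_full_def avg_loss_def diff_divide_distrib sum_subtractf
      sum_divide_distrib mult_ac)

text \<open>The assumption \<open>step\<close> is the absorption condition of one inner loop,
  \<open>\<alpha> * (real m)\<^sup>2 / 2 \<le> \<kappa>\<close> in the notation used there, cleared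
  of denominators in \<eta>. The theorem derives it from its condition on \<open>b\<close>.\<close>

locale zo_prox_svrg =
  fixes f :: "nat \<Rightarrow> real ^ 'd \<Rightarrow> real" and \<psi> :: "real ^ 'd \<Rightarrow> real"
    and x0 xstar :: "real ^ 'd" and L \<mu> \<eta> :: real and n b S m :: nat and samp :: sampling
  assumes n: "n \<ge> 1" and b: "b \<ge> 1" and S: "S \<ge> 1" and m: "m \<ge> 1"
    and bn: "samp = Without_Replacement \<Longrightarrow> b \<le> n"
    and L: "L > 0" and \<mu>: "\<mu> > 0" and \<eta>: "\<eta> > 0"
    and smooth: "\<And>i. i \<in> {1..n} \<Longrightarrow> L_smooth L (f i)"
    and convex: "convex_on UNIV \<psi>"
    and optimal: "\<And>x. objective n f \<psi> xstar \<le> objective n f \<psi> x"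
    and step: "(\<eta> * L)\<^sup>2 * real CARD('d) * (real m)\<^sup>2 / real b + \<eta> * L \<le> 1"
begin

abbreviation F where "F \<equiv> objective n f \<psi>"
abbreviation G where "G x \<equiv> (norm (gradient_mapping \<eta> (avg_loss n f) \<psi> x))\<^sup>2"
abbreviation \<gamma> where "\<gamma> \<equiv> \<eta> / 2 - L * \<eta>\<^sup>2"
abbreviation P where "P \<equiv> batches_pmf samp n b S m"
abbreviation E where "E \<equiv> measure_pmf.expectation P"
abbreviation X where "X \<equiv> zo_iterate \<mu> n f \<psi> \<eta> m x0"

section \<open>Error of the gradient estimate and descent in expectation\<close>

lemma smooth_avg: "L_smooth L (avg_loss n f)"
  using smooth n by (rule L_smooth_avg_loss)

lemma finite_P: "finite (set_pmf P)"
  unfolding batches_pmf_def using finite_set_batch_pmf[OF n bn] by (intro finite_set_Pi_pmf) auto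

lemma integrable_P [simp]: "integrable P (g :: _ \<Rightarrow> real)"
  by (rule integrable_measure_pmf_finite[OF finite_P])

lemma vhat_error:
  "measure_pmf.expectation (batch_pmf samp n b)
      (\<lambda>I. (norm (gradient (avg_loss n f) x - vhat \<mu> n f I x y))\<^sup>2)
    \<le> 2 * L\<^sup>2 * real CARD('d) / real b * (norm (x - y))\<^sup>2 + L\<^sup>2 * real CARD('d) * \<mu>\<^sup>2 / 2"
proof -
  define \<zeta> where "\<zeta> i = coosge \<mu> (f i) x - coosge \<mu> (f i) y" for i
  define e where "e I = (1 / real (size I)) *\<^sub>R (\<Sum>i\<in>#I. \<zeta> i) - (1 / real n) *\<^sub>R (\<Sum>i=1..n. \<zeta> i)" for I
  define g where "g = coosge \<mu> (avg_loss n f) x - gradient (avg_loss n f) x"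
  \<comment> \<open>The mean of \<zeta> is the full estimate at \<open>x\<close> minus the one at
    \<open>y\<close>. So the sampling error \<open>e\<close> involves only differences between the
    two points, which is the variance reduction; \<open>g\<close> is the bias at
    \<open>x\<close>.\<close>
  have v: "vhat \<mu> n f I x y - gradient (avg_loss n f) x = e I + g" for I
  proof -
    have "(\<Sum>i\<in>#I. \<zeta> i) = (\<Sum>i\<in>#I. coosge \<mu> (f i) x) - (\<Sum>i\<in>#I. coosge \<mu> (f i) y)"
      unfolding \<zeta>_def by (induction I) simp_all
    then show ?thesis
      by (simp add: vhat_def coosge_batch_def e_def g_def coosge_full_eq[symmetric] coosge_full_def
          \<zeta>_def sum_subtractf scaleR_diff_right)
  qed
  have fin: "finite (set_pmf (batch_pmf samp n b))"
    by (rule finite_set_batch_pmf[OF n bn])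
  have "measure_pmf.expectation (batch_pmf samp n b)
      (\<lambda>I. (norm (gradient (avg_loss n f) x - vhat \<mu> n f I x y))\<^sup>2)
      \<le> measure_pmf.expectation (batch_pmf samp n b) (\<lambda>I. 2 * (norm (e I))\<^sup>2 + 2 * (norm g)\<^sup>2)"
  proof (rule expectation_mono_finite[OF fin])
    fix I
    have "0 \<le> (norm (e I - g))\<^sup>2"
      by simp
    then have "(norm (e I + g))\<^sup>2 \<le> 2 * (norm (e I))\<^sup>2 + 2 * (norm g)\<^sup>2"
      unfolding power2_norm_eq_inner by (simp add: inner_add inner_diff inner_commute)
    then show "(norm (gradient (avg_loss n f) x - vhat \<mu> n f I x y))\<^sup>2
        \<le> 2 * (norm (e I))\<^sup>2 + 2 * (norm g)\<^sup>2"
      by (simp add: v[symmetric] norm_minus_commute)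
  qed
  also have "\<dots> = 2 * measure_pmf.expectation (batch_pmf samp n b) (\<lambda>I. (norm (e I))\<^sup>2) + 2 * (norm g)\<^sup>2"
    using fin by (simp add: integrable_measure_pmf_finite)
  also have "measure_pmf.expectation (batch_pmf samp n b) (\<lambda>I. (norm (e I))\<^sup>2)
      \<le> 1 / (real b * real n) * (\<Sum>i=1..n. (norm (\<zeta> i))\<^sup>2)"
    unfolding e_def by (rule expectation_batch_average_le[OF n b bn])
  also have "\<dots> \<le> 1 / (real b * real n) * (\<Sum>i=1..n. real CARD('d) * (L * norm (x - y))\<^sup>2)"
    unfolding \<zeta>_def using smooth \<mu> by (intro mult_left_mono sum_mono coosge_Lipschitz) auto
  also have "(norm g)\<^sup>2 \<le> real CARD('d) * (L * \<mu> / 2)\<^sup>2"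
    unfolding g_def by (rule coosge_error[OF smooth_avg \<mu>])
  finally show ?thesis
    using n by (simp add: power_mult_distrib power_divide algebra_simps)
qed

lemma expected_vhat_error:
  assumes "s \<in> {1..S}" and "t < m"
  shows "E (\<lambda>B. (norm (gradient (avg_loss n f) (X B s t) - vhat \<mu> n f (B (s, t)) (X B s t) (X B s 0)))\<^sup>2)
    \<le> 2 * L\<^sup>2 * real CARD('d) / real b * E (\<lambda>B. (norm (X B s t - X B s 0))\<^sup>2)
      + L\<^sup>2 * real CARD('d) * \<mu>\<^sup>2 / 2"
proof -
  define err where "err I = (\<lambda>(x, y). (norm (gradient (avg_loss n f) x - vhat \<mu> n f I x y))\<^sup>2)" for I
  define bnd where "bnd = (\<lambda>(x, y). 2 * L\<^sup>2 * real CARD('d) / real b * (norm (x - y :: real ^ 'd))\<^sup>2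
    + L\<^sup>2 * real CARD('d) * \<mu>\<^sup>2 / 2)"
  \<comment> \<open>Both iterates form one state, as the averaging over a fresh coordinate takes a
    single function of the past.\<close>
  define Y where "Y B = (X B s t, X B s 0)" for B
  have "E (\<lambda>B. err (B (s, t)) (Y B)) \<le> E (\<lambda>B. bnd (Y B))"
    unfolding batches_pmf_def
  proof (rule expectation_Pi_pmf_fresh_le)
    show "finite (set_pmf (batch_pmf samp n b))"
      by (rule finite_set_batch_pmf[OF n bn])
    show "Y (B((s, t) := I)) = Y B" for B I
      by (simp add: Y_def zo_iterate_fresh)
    show "measure_pmf.expectation (batch_pmf samp n b) (\<lambda>I. err I z) \<le> bnd z" for z
      using vhat_error by (cases z) (simp add: err_def bnd_def)
  qed (use assms in auto)
  then show ?thesis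
    by (simp add: err_def bnd_def Y_def)
qed

lemma expected_loop_descent:
  assumes s: "s \<in> {1..S}"
  shows "E (\<lambda>B. F (X B s m)) + \<gamma> * (\<Sum>t<m. E (\<lambda>B. G (X B s t)))
    \<le> E (\<lambda>B. F (X B s 0)) + real m * (L\<^sup>2 * real CARD('d) * \<mu>\<^sup>2 * \<eta> / 4)"
proof -
  define \<phi> where "\<phi> t = E (\<lambda>B. F (X B s t))" for t
  define D where "D t = E (\<lambda>B. (norm (X B s (Suc t) - X B s t))\<^sup>2)" for t
  define R where "R t = E (\<lambda>B. (norm (X B s t - X B s 0))\<^sup>2)" for t
  \<comment> \<open>\<open>\<kappa>\<close> is the gain per squared step length;
    \<open>\<nu>\<close> and \<open>\<alpha>\<close> are \<open>\<eta> / 2\<close> times the bias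
    term and the coefficient of the sampling term in the error of \<open>vhat\<close>.\<close>
  define \<kappa> where "\<kappa> = 1 / (2 * \<eta>) - L / 2"
  define \<nu> where "\<nu> = L\<^sup>2 * real CARD('d) * \<mu>\<^sup>2 * \<eta> / 4"
  define \<alpha> where "\<alpha> = L\<^sup>2 * real CARD('d) * \<eta> / real b"
  have one_step: "\<gamma> * E (\<lambda>B. G (X B s t)) + \<kappa> * D t \<le> (\<phi> t - \<phi> (Suc t)) + \<alpha> * R t + \<nu>"
    if t: "t < m" for t
  proof -
    have "E (\<lambda>B. F (X B s (Suc t)) + \<gamma> * G (X B s t) + \<kappa> * (norm (X B s (Suc t) - X B s t))\<^sup>2)
      \<le> E (\<lambda>B. F (X B s t) + \<eta> / 2 * (norm (gradient (avg_loss n f) (X B s t)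
          - vhat \<mu> n f (B (s, t)) (X B s t) (X B s 0)))\<^sup>2)"
      unfolding objective_def zo_iterate_Suc \<kappa>_def
      by (intro expectation_mono_finite[OF finite_P]
          inexact_prox_step_descent[OF smooth_avg convex \<eta>])
    moreover have "\<eta> / 2 * E (\<lambda>B. (norm (gradient (avg_loss n f) (X B s t)
          - vhat \<mu> n f (B (s, t)) (X B s t) (X B s 0)))\<^sup>2)
        \<le> \<eta> / 2 * (2 * L\<^sup>2 * real CARD('d) / real b * R t + L\<^sup>2 * real CARD('d) * \<mu>\<^sup>2 / 2)"
      unfolding R_def using \<eta> by (intro mult_left_mono expected_vhat_error[OF s t]) auto
    moreover have "\<eta> / 2 * (2 * L\<^sup>2 * real CARD('d) / real b * R t + L\<^sup>2 * real CARD('d) * \<mu>\<^sup>2 / 2)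
        = \<alpha> * R t + \<nu>"
      by (simp add: \<alpha>_def \<nu>_def field_simps)
    ultimately show ?thesis
      by (simp add: \<phi>_def D_def)
  qed
  have "(\<Sum>t<m. \<gamma> * E (\<lambda>B. G (X B s t)) + \<kappa> * D t) \<le> (\<Sum>t<m. (\<phi> t - \<phi> (Suc t)) + \<alpha> * R t + \<nu>)"
    by (intro sum_mono one_step) simp
  then have "\<gamma> * (\<Sum>t<m. E (\<lambda>B. G (X B s t))) + \<kappa> * (\<Sum>t<m. D t)
      \<le> \<phi> 0 - \<phi> m + \<alpha> * (\<Sum>t<m. R t) + real m * \<nu>"
    by (simp add: sum.distrib sum_distrib_left[symmetric] sum_lessThan_telescope')
  moreover have "\<alpha> * (\<Sum>t<m. R t) \<le> \<kappa> * (\<Sum>t<m. D t)"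
  proof -
    have D: "(\<Sum>t<m. D t) \<ge> 0"
      by (intro sum_nonneg) (simp add: D_def)
    have "(\<Sum>t<m. R t) = E (\<lambda>B. \<Sum>t<m. (norm (X B s t - X B s 0))\<^sup>2)"
      by (simp add: R_def)
    also have "\<dots> \<le> E (\<lambda>B. (real m)\<^sup>2 / 2 * (\<Sum>t<m. (norm (X B s (Suc t) - X B s t))\<^sup>2))"
      by (intro expectation_mono_finite[OF finite_P] sum_norm_sq_from_start_le)
    also have "\<dots> = (real m)\<^sup>2 / 2 * (\<Sum>t<m. D t)"
      by (simp add: D_def)
    finally have "\<alpha> * (\<Sum>t<m. R t) \<le> \<alpha> * ((real m)\<^sup>2 / 2 * (\<Sum>t<m. D t))"
      using \<eta> by (intro mult_left_mono) (auto simp: \<alpha>_def)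
    also have "\<dots> = (\<alpha> * (real m)\<^sup>2 / 2) * (\<Sum>t<m. D t)"
      by simp
    also have "\<dots> \<le> \<kappa> * (\<Sum>t<m. D t)"
    proof (rule mult_right_mono[OF _ D])
      have "\<alpha> * (real m)\<^sup>2 / 2 = ((\<eta> * L)\<^sup>2 * real CARD('d) * (real m)\<^sup>2 / real b) / (2 * \<eta>)"
        using \<eta> by (simp add: \<alpha>_def power2_eq_square field_simps)
      also have "\<dots> \<le> (1 - \<eta> * L) / (2 * \<eta>)"
        using step \<eta> by (intro divide_right_mono) auto
      also have "\<dots> = \<kappa>"
        using \<eta> by (simp add: \<kappa>_def field_simps)
      finally show "\<alpha> * (real m)\<^sup>2 / 2 \<le> \<kappa>" .
    qed
    finally show ?thesis .
  qed
  ultimately show ?thesis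
    unfolding \<phi>_def \<nu>_def by linarith
qed

lemma expected_total_descent:
  assumes "s \<ge> 1" and "s \<le> S"
  shows "E (\<lambda>B. F (X B s m)) + \<gamma> * (\<Sum>s'=1..s. \<Sum>t<m. E (\<lambda>B. G (X B s' t)))
    \<le> E (\<lambda>B. F (X B 1 0)) + real s * (real m * (L\<^sup>2 * real CARD('d) * \<mu>\<^sup>2 * \<eta> / 4))"
  using assms
proof (induction s rule: nat_induct_at_least)
  case base
  then show ?case
    using expected_loop_descent[of 1] by simp
next
  case (Suc s)
  \<comment> \<open>Stated over plain real variables so that the nested sums and expectations stay
    opaque to linear arithmetic.\<close>
  have arith: "a + c \<le> e + k"
    if "c = c1 + c2" "k = k1 + k2" "a2 = a1" "a + c2 \<le> a2 + k2" "a1 + c1 \<le> e + k1"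
    for a a1 a2 c c1 c2 e k k1 k2 :: real
    using that by linarith
  let ?\<nu> = "real m * (L\<^sup>2 * real CARD('d) * \<mu>\<^sup>2 * \<eta> / 4)"
  have "\<gamma> * (\<Sum>s'=1..Suc s. \<Sum>t<m. E (\<lambda>B. G (X B s' t)))
      = \<gamma> * (\<Sum>s'=1..s. \<Sum>t<m. E (\<lambda>B. G (X B s' t))) + \<gamma> * (\<Sum>t<m. E (\<lambda>B. G (X B (Suc s) t)))"
    unfolding distrib_left[symmetric] by simp
  moreover have "real (Suc s) * ?\<nu> = real s * ?\<nu> + ?\<nu>"
    by (simp add: distrib_right)
  moreover have "E (\<lambda>B. F (X B (Suc s) 0)) = E (\<lambda>B. F (X B s m))"
    by (simp add: zo_iterate_next_loop[OF Suc.hyps])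
  moreover have "E (\<lambda>B. F (X B (Suc s) m)) + \<gamma> * (\<Sum>t<m. E (\<lambda>B. G (X B (Suc s) t)))
      \<le> E (\<lambda>B. F (X B (Suc s) 0)) + ?\<nu>"
    using Suc.prems by (intro expected_loop_descent) simp
  moreover have "E (\<lambda>B. F (X B s m)) + \<gamma> * (\<Sum>s'=1..s. \<Sum>t<m. E (\<lambda>B. G (X B s' t)))
      \<le> E (\<lambda>B. F (X B 1 0)) + real s * ?\<nu>"
    using Suc.prems by (intro Suc.IH) simp
  ultimately show ?case
    by (rule arith)
qed

lemma expectation_zo_output:
  fixes g :: "real ^ 'd \<Rightarrow> real"
  shows "measure_pmf.expectation (zo_output samp \<mu> n f \<psi> \<eta> b S m x0) g
    = (\<Sum>s=1..S. \<Sum>t=1..m. E (\<lambda>B. g (X B s t))) / (real m * real S)"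
proof -
  let ?A = "{1..S} \<times> {1..m}"
  have A: "finite ?A" "?A \<noteq> {}"
    using S m by auto
  have "measure_pmf.expectation (zo_output samp \<mu> n f \<psi> \<eta> b S m x0) g
      = E (\<lambda>B. measure_pmf.expectation (pmf_of_set ?A) (\<lambda>(s, t). g (X B s t)))"
    unfolding zo_output_def integral_map_pmf
    using A finite_P by (subst expectation_pair_pmf_finite) (auto simp: case_prod_unfold)
  also have "\<dots> = E (\<lambda>B. (\<Sum>s=1..S. \<Sum>t=1..m. g (X B s t)) / (real m * real S))"
    using A by (simp add: integral_pmf_of_set sum.cartesian_product mult.commute)
  also have "\<dots> = (\<Sum>s=1..S. \<Sum>t=1..m. E (\<lambda>B. g (X B s t))) / (real m * real S)"
    by simp
  finally show ?thesis .
qed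

text \<open>The output omits the iterate \<open>X 1 0\<close> and includes the last one, \<open>X S m\<close>. The gradient
  mapping at the last iterate is paid for by its remaining gap to the optimum, through one exact
  proximal gradient step.\<close>

lemma expected_output_bound:
  assumes "\<gamma> > 0"
  shows "measure_pmf.expectation (zo_output samp \<mu> n f \<psi> \<eta> b S m x0) G
    \<le> E (\<lambda>B. F (X B 1 0) - F xstar) / (real (m * S) * \<gamma>)
      + L\<^sup>2 * real CARD('d) * \<mu>\<^sup>2 * \<eta> / (4 * \<gamma>)"
proof -
  define a where "a s t = E (\<lambda>B. G (X B s t))" for s t
  define \<nu> where "\<nu> = L\<^sup>2 * real CARD('d) * \<mu>\<^sup>2 * \<eta> / 4"
  have "a (Suc s) 0 = a s m" if "s \<ge> 1" for s
    by (simp add: a_def zo_iterate_next_loop[OF that])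
  then have "(\<Sum>s=1..S. \<Sum>t=1..m. a s t) + a 1 0 = (\<Sum>s=1..S. \<Sum>t<m. a s t) + a S m"
    using S by (intro sum_shift_loops)
  moreover have "a 1 0 \<ge> 0"
    by (simp add: a_def)
  ultimately have "(\<Sum>s=1..S. \<Sum>t=1..m. a s t) \<le> (\<Sum>s=1..S. \<Sum>t<m. a s t) + a S m"
    by linarith
  then have "\<gamma> * (\<Sum>s=1..S. \<Sum>t=1..m. a s t) \<le> \<gamma> * (\<Sum>s=1..S. \<Sum>t<m. a s t) + \<gamma> * a S m"
    using assms by (simp add: distrib_left[symmetric] del: distrib_left_numeral)
  also have "\<gamma> * a S m \<le> E (\<lambda>B. F (X B S m)) - F xstar"
  proof -
    have "E (\<lambda>B. \<gamma> * G (X B S m)) \<le> E (\<lambda>B. F (X B S m) - F xstar)"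
      using L optimal unfolding objective_def
      by (intro expectation_mono_finite[OF finite_P]
          gradient_mapping_le_gap[OF smooth_avg convex \<eta>]) auto
    then show ?thesis
      by (simp add: a_def)
  qed
  also have "\<gamma> * (\<Sum>s=1..S. \<Sum>t<m. a s t) + (E (\<lambda>B. F (X B S m)) - F xstar)
      \<le> E (\<lambda>B. F (X B 1 0) - F xstar) + real (m * S) * \<nu>"
    using expected_total_descent[OF S order_refl]
    by (simp add: a_def \<nu>_def algebra_simps)
  finally have "(\<Sum>s=1..S. \<Sum>t=1..m. a s t)
      \<le> (E (\<lambda>B. F (X B 1 0) - F xstar) + real (m * S) * \<nu>) / \<gamma>"
    using assms by (simp add: pos_le_divide_eq mult.commute)
  then have "(\<Sum>s=1..S. \<Sum>t=1..m. a s t) / (real m * real S)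
      \<le> (E (\<lambda>B. F (X B 1 0) - F xstar) + real (m * S) * \<nu>) / \<gamma> / (real m * real S)"
    by (rule divide_right_mono) simp
  also have "\<dots> = E (\<lambda>B. F (X B 1 0) - F xstar) / (real (m * S) * \<gamma>) + \<nu> / \<gamma>"
    using assms m S by (simp add: add_divide_distrib mult.commute)
  finally show ?thesis
    unfolding expectation_zo_output a_def \<nu>_def by simp
qed

end

subsection \<open>Convergence rate\<close>

text \<open>The Landau symbols become explicit: \<open>C\<close> is the constant in the assumption
  on \<mu>, and \<open>L\<^sup>2 * C\<^sup>2\<close> is the resulting constant in front of
  \<open>d / T\<close>. The second implication obtains the condition on \<open>b\<close> from the
  rounded powers of \<open>n\<close>.\<close>

theorem theorem1:
  fixes f :: "nat \<Rightarrow> real ^ 'd \<Rightarrow> real"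
    and \<psi> :: "real ^ 'd \<Rightarrow> real"
    and x0 xstar :: "real ^ 'd"
    and L \<sigma> \<mu> \<eta> \<rho> \<beta> \<gamma> C :: real
    and n b S m T :: nat
    and c :: "nat \<Rightarrow> real"
    and samp :: sampling
  defines "d \<equiv> real CARD('d)"
    and "F \<equiv> objective n f \<psi>"
  assumes "n \<ge> 1" and "b \<ge> 1" and "S \<ge> 1" and "m \<ge> 1"
    and "samp = Without_Replacement \<Longrightarrow> b \<le> n"
    and differentiable: "\<And>i x. i \<in> {1..n} \<Longrightarrow> f i differentiable (at x)"
    and "L > 0"
    and smooth: "\<And>i x y. i \<in> {1..n} \<Longrightarrow>
           norm (gradient (f i) x - gradient (f i) y) \<le> L * norm (x - y)"
    and bounded: "\<And>i x. i \<in> {1..n} \<Longrightarrow> (norm (gradient (f i) x))\<^sup>2 \<le> \<sigma>\<^sup>2"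
    and convex: "convex_on UNIV \<psi>"
    and optimal: "\<And>x. F xstar \<le> F x"
    and "\<mu> > 0"
    and "\<beta> > 0"
    and "\<And>t. t < m \<Longrightarrow> c t = delta samp b n * L\<^sup>2 * d * \<eta> / real b + c (Suc t) * (1 + \<beta>)"
    and "c m = 0"
    and "T = m * S"
    and "\<eta> = \<rho> / (d * L)" and "0 < \<rho>" and "\<rho> < 1 / 2"
    and "\<gamma> = \<eta> / 2 - L * \<eta>\<^sup>2"
  shows "(8 * \<rho>\<^sup>2 * (real m)\<^sup>2 / real b + \<rho> \<le> 1 \<longrightarrow>
           measure_pmf.expectation (zo_output samp \<mu> n f \<psi> \<eta> b S m x0)
             (\<lambda>x. (norm (gradient_mapping \<eta> (avg_loss n f) \<psi> x))\<^sup>2)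
           \<le> measure_pmf.expectation (batches_pmf samp n b S m)
               (\<lambda>B. F (zo_iterate \<mu> n f \<psi> \<eta> m x0 B 1 0) - F xstar) / (real T * \<gamma>)
             + L\<^sup>2 * d\<^sup>2 * \<mu>\<^sup>2 * \<eta> / (4 * \<gamma>))
       \<and> (b = nat \<lfloor>real n powr (2 / 3)\<rfloor> \<and> m = nat \<lfloor>real n powr (1 / 3)\<rfloor> \<and> \<rho> = 1 / 4
            \<and> \<mu> \<le> C / sqrt (d * real T) \<longrightarrow>
           measure_pmf.expectation (zo_output samp \<mu> n f \<psi> \<eta> b S m x0)
             (\<lambda>x. (norm (gradient_mapping \<eta> (avg_loss n f) \<psi> x))\<^sup>2)
           \<le> 16 * d * L * measure_pmf.expectation (batches_pmf samp n b S m)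
               (\<lambda>B. F (zo_iterate \<mu> n f \<psi> \<eta> m x0 B 1 0) - F xstar) / real T
             + (L\<^sup>2 * C\<^sup>2) * (d / real T))"
proof -
  have d1: "d \<ge> 1"
    by (simp add: d_def Suc_leI)
  have \<eta>L: "\<eta> * L = \<rho> / d"
    using \<open>\<eta> = \<rho> / (d * L)\<close> \<open>L > 0\<close> by simp
  have \<eta>0: "\<eta> > 0"
    using \<open>\<eta> = \<rho> / (d * L)\<close> \<open>L > 0\<close> \<open>0 < \<rho>\<close> d1 by simp
  have \<rho>d: "\<rho> / d \<le> \<rho>"
    using d1 \<open>0 < \<rho>\<close> by (simp add: divide_le_eq mult_le_cancel_left1)
  have \<gamma>_eq: "\<gamma> = \<eta> * (1 / 2 - \<rho> / d)"
    unfolding \<open>\<gamma> = \<eta> / 2 - L * \<eta>\<^sup>2\<close> \<eta>L[symmetric] by (simp add: power2_eq_square algebra_simps)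
  have \<gamma>0: "\<gamma> > 0"
    unfolding \<gamma>_eq using \<eta>0 \<rho>d \<open>\<rho> < 1 / 2\<close> by (intro mult_pos_pos; linarith)
  have T0: "T \<ge> 1"
    using \<open>T = m * S\<close> \<open>m \<ge> 1\<close> \<open>S \<ge> 1\<close> by simp
  let ?out = "measure_pmf.expectation (zo_output samp \<mu> n f \<psi> \<eta> b S m x0)
    (\<lambda>x. (norm (gradient_mapping \<eta> (avg_loss n f) \<psi> x))\<^sup>2)"
  let ?gap = "measure_pmf.expectation (batches_pmf samp n b S m)
    (\<lambda>B. F (zo_iterate \<mu> n f \<psi> \<eta> m x0 B 1 0) - F xstar)"
  have gap0: "?gap \<ge> 0"
    using optimal by (intro Bochner_Integration.integral_nonneg) simp
  have main: "?out \<le> ?gap / (real T * \<gamma>) + L\<^sup>2 * d\<^sup>2 * \<mu>\<^sup>2 * \<eta> / (4 * \<gamma>)"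
    if cond: "8 * \<rho>\<^sup>2 * (real m)\<^sup>2 / real b + \<rho> \<le> 1"
  proof -
    \<comment> \<open>As \<open>\<eta> * L = \<rho> / d\<close>, the product
      \<open>(\<eta> * L)\<^sup>2 * d\<close> is \<open>\<rho>\<^sup>2 / d\<close>, which
      \<open>8 * \<rho>\<^sup>2\<close> dominates.\<close>
    have "(\<eta> * L)\<^sup>2 * d * (real m)\<^sup>2 / real b + \<eta> * L \<le> 8 * \<rho>\<^sup>2 * (real m)\<^sup>2 / real b + \<rho>"
    proof -
      have "(\<rho> / d)\<^sup>2 * d = \<rho> * (\<rho> / d)"
        using d1 by (simp add: power2_eq_square)
      also have "\<dots> \<le> \<rho> * \<rho>"
        using \<rho>d \<open>0 < \<rho>\<close> by (intro mult_left_mono) auto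
      also have "\<dots> \<le> 8 * \<rho>\<^sup>2"
        by (simp add: power2_eq_square)
      finally have "(\<rho> / d)\<^sup>2 * d * (real m)\<^sup>2 / real b \<le> 8 * \<rho>\<^sup>2 * (real m)\<^sup>2 / real b"
        by (intro divide_right_mono mult_right_mono) auto
      with \<rho>d show ?thesis
        unfolding \<eta>L by linarith
    qed
    with cond have step: "(\<eta> * L)\<^sup>2 * real CARD('d) * (real m)\<^sup>2 / real b + \<eta> * L \<le> 1"
      unfolding d_def by linarith
    interpret zo_prox_svrg f \<psi> x0 xstar L \<mu> \<eta> n b S m samp
      using \<open>n \<ge> 1\<close> \<open>b \<ge> 1\<close> \<open>S \<ge> 1\<close> \<open>m \<ge> 1\<close> \<open>samp = Without_Replacement \<Longrightarrow> b \<le> n\<close>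
        \<open>L > 0\<close> \<open>\<mu> > 0\<close> \<eta>0 differentiable smooth convex optimal step
      by unfold_locales (auto simp: L_smooth_def F_def)
    have "?out \<le> ?gap / (real T * \<gamma>) + L\<^sup>2 * d * \<mu>\<^sup>2 * \<eta> / (4 * \<gamma>)"
      using expected_output_bound \<gamma>0
      unfolding \<open>\<gamma> = \<eta> / 2 - L * \<eta>\<^sup>2\<close> \<open>T = m * S\<close> d_def F_def by simp
    \<comment> \<open>Summing the squared errors of the coordinates gives a single factor
      \<open>d\<close>; \<open>1 \<le> d\<close> passes to the stated square.\<close>
    also have "L\<^sup>2 * d * \<mu>\<^sup>2 * \<eta> / (4 * \<gamma>) \<le> L\<^sup>2 * d\<^sup>2 * \<mu>\<^sup>2 * \<eta> / (4 * \<gamma>)"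
      using d1 \<gamma>0 \<eta>0
      by (intro divide_right_mono mult_right_mono mult_left_mono) (auto simp: power2_eq_square)
    finally show ?thesis
      by simp
  qed
  moreover have "?out \<le> 16 * d * L * ?gap / real T + (L\<^sup>2 * C\<^sup>2) * (d / real T)"
    if b: "b = nat \<lfloor>real n powr (2 / 3)\<rfloor>" and m: "m = nat \<lfloor>real n powr (1 / 3)\<rfloor>"
      and \<rho>: "\<rho> = 1 / 4" and \<mu>: "\<mu> \<le> C / sqrt (d * real T)"
  proof -
    have "real m \<le> real n powr (1 / 3)"
      unfolding m by simp
    then have "(real m)\<^sup>2 \<le> (real n powr (1 / 3))\<^sup>2"
      by (intro power_mono) auto
    also have "\<dots> = real n powr (2 / 3)"
      by (simp add: power2_eq_square powr_add[symmetric])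
    \<comment> \<open>The integer \<open>m\<^sup>2\<close> lies below \<open>n powr (2 / 3)\<close>,
      hence below its integer part. With \<open>\<rho> = 1 / 4\<close> the condition on
      \<open>b\<close> then reads at most \<open>1 / 2 + 1 / 4\<close>.\<close>
    finally have "m\<^sup>2 \<le> b"
      unfolding b by (simp add: le_nat_floor)
    then have "(real m)\<^sup>2 \<le> real b"
      by (metis of_nat_le_iff of_nat_power)
    then have "(real m)\<^sup>2 / real b \<le> 1"
      using \<open>b \<ge> 1\<close> by simp
    then have "8 * \<rho>\<^sup>2 * (real m)\<^sup>2 / real b + \<rho> \<le> 1"
      unfolding \<rho> by (simp add: power2_eq_square)
    note main[OF this]
    \<comment> \<open>Here \<open>\<gamma> = \<eta> * (1 / 2 - \<rho> / d)\<close> with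
      \<open>\<rho> / d \<le> 1 / 4\<close>. The bound yields the factor
      \<open>4 / \<eta> = 16 * d * L\<close> on the gap, which is nonnegative by optimality, and
      reduces \<open>\<eta> / (4 * \<gamma>)\<close> to at most 1.\<close>
    moreover have \<gamma>_lower: "\<eta> / 4 \<le> \<gamma>"
      unfolding \<gamma>_eq using \<eta>0 \<rho>d \<rho> by simp
    moreover have "?gap / (real T * \<gamma>) \<le> ?gap / (real T * (\<eta> / 4))"
      using gap0 T0 \<gamma>0 \<eta>0 \<gamma>_lower by (intro divide_left_mono mult_left_mono mult_pos_pos) auto
    moreover have "?gap / (real T * (\<eta> / 4)) = 16 * d * L * ?gap / real T"
      using \<open>L > 0\<close> d1 unfolding \<open>\<eta> = \<rho> / (d * L)\<close> \<rho> by (simp add: field_simps)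
    moreover have "L\<^sup>2 * d\<^sup>2 * \<mu>\<^sup>2 * \<eta> / (4 * \<gamma>) \<le> (L\<^sup>2 * C\<^sup>2) * (d / real T)"
    proof -
      have "\<mu>\<^sup>2 \<le> (C / sqrt (d * real T))\<^sup>2"
        using \<mu> \<open>\<mu> > 0\<close> by (intro power_mono) auto
      also have "\<dots> = C\<^sup>2 / (d * real T)"
        using d1 by (simp add: power_divide)
      finally have "L\<^sup>2 * d\<^sup>2 * \<mu>\<^sup>2 \<le> L\<^sup>2 * d\<^sup>2 * (C\<^sup>2 / (d * real T))"
        by (intro mult_left_mono) auto
      moreover have "\<eta> / (4 * \<gamma>) \<le> 1"
        using \<gamma>_lower \<gamma>0 by simp
      ultimately have "L\<^sup>2 * d\<^sup>2 * \<mu>\<^sup>2 * (\<eta> / (4 * \<gamma>)) \<le> L\<^sup>2 * d\<^sup>2 * (C\<^sup>2 / (d * real T)) * 1"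
        by (rule mult_mono) (use \<eta>0 \<gamma>0 d1 in auto)
      then show ?thesis
        using d1 by (simp add: power2_eq_square field_simps)
    qed
    ultimately show ?thesis
      by linarith
  qed
  ultimately show ?thesis
    by blast
qed

end
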